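(* Let $G$ be a $6$-dimensional almost-abelian Lie group with a left-invariant Kähler structure $(\omega,J)$, let $\Psi$ be a left-invariant nowhere vanishing holomorphic $(3,0)$-form on $(G,J)$, and let $\pi:E\to G$ be a flat holomorphic bundle (curvature $F\equiv0$). Then $(\omega,J)$ solves the Hull-Strominger system for any Gauduchon connection $\nabla^\tau$, $\tau\in\mathbb{R}$, and any $\alpha'\in\mathbb{R}$; that is, $$\omega^2\wedge F=0,\quad F^{2,0}=F^{0,2}=0,\quad i\partial\overline\partial\omega=\frac{\alpha'}{4}\big(\operatorname{tr}(\Omega^\tau\wedge\Omega^\tau)-\operatorname{tr}(F\wedge F)\big),\quad d(\Vert\Psi\Vert_\omega\,\omega^2)=0.$$
   Context: A Lie group is almost-abelian if its Lie algebra has a codimension-one abelian ideal. A Hermitian metric is identified with its fundamental $(1,1)$-form $\omega$; Kähler means $d\omega=0$. $\Vert\Psi\Vert_\omega$ is the pointwise norm, $\Vert\Psi\Vert_\omega^2\,\omega^3/3!=i\,\Psi\wedge\overline\Psi$. Gauduchon connections: $\nabla^\tau=\frac{1+\tau}{2}\nabla^{Ch}+\frac{1-\tau}{2}\nabla^{B}$, where $\nabla^{Ch}$ is the Chern connection of $(\omega,J)$ and $\nabla^{B}$ the Bismut connection (the unique Hermitian connection with totally skew-symmetric torsion). $\Omega^\tau$ is the curvature of $\nabla^\tau$. In a left-invariant orthonormal frame, with connection 1-forms defined by $\nabla^\tau_Xe_j=\sum_i\sigma^i_j(X)e_i$, the curvature 2-forms are $\Omega^i_j=d\sigma^i_j+\sum_k\sigma^i_k\wedge\sigma^k_j$,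 and by convention $\operatorname{tr}(\Omega^\tau\wedge\Omega^\tau)=\sum_{1\le i<j\le6}\Omega^i_j\wedge\Omega^i_j$. *)

theory Defs
  imports "HOL-Analysis.Analysis" "HOL-Algebra.Group" "HOL-Library.Function_Algebras"
begin

section \<open>Lie groups\<close>

text \<open>For open \<open>U\<close>: a function is \<open>C\<^sup>k\<^sup>+\<^sup>1\<close> iff it is differentiable and all its directional
  derivatives are \<open>C\<^sup>k\<close>.\<close>

primrec k_smooth_on ::
    "nat \<Rightarrow> 'a::euclidean_space set \<Rightarrow> ('a \<Rightarrow> 'b::real_normed_vector) \<Rightarrow> bool" where
  "k_smooth_on 0 U f \<longleftrightarrow> continuous_on U f"
| "k_smooth_on (Suc k) U f \<longleftrightarrow>
     (\<forall>x\<in>U. f differentiable (at x)) \<and>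
     (\<forall>v. k_smooth_on k U (\<lambda>x. frechet_derivative f (at x) v))"

definition smooth_on :: "'a::euclidean_space set \<Rightarrow> ('a \<Rightarrow> 'b::real_normed_vector) \<Rightarrow> bool" where
  "smooth_on U f \<longleftrightarrow> (\<forall>k. k_smooth_on k U f)"

text \<open>A chart is a pair of a domain and a coordinate map; only the values of the coordinate map on
  the domain are relevant.\<close>

type_synonym ('g, 'n) atlas = "('g set \<times> ('g \<Rightarrow> real ^ 'n)) set"

definition smooth_atlas :: "('g::topological_space, 'n::finite) atlas \<Rightarrow> bool" where
  "smooth_atlas A \<longleftrightarrow>
     (\<Union>(U, \<phi>)\<in>A. U) = UNIV \<and>
     (\<forall>(U, \<phi>)\<in>A. open U \<and> open (\<phi> ` U) \<and> homeomorphism U (\<phi> ` U) \<phi> (inv_into U \<phi>)) \<and>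
     (\<forall>(U, \<phi>)\<in>A. \<forall>(V, \<psi>)\<in>A. smooth_on (\<phi> ` (U \<inter> V)) (\<psi> \<circ> inv_into U \<phi>))"

definition smooth_fun_on ::
    "('g::topological_space, 'n::finite) atlas \<Rightarrow> 'g set \<Rightarrow> ('g \<Rightarrow> complex) \<Rightarrow> bool" where
  "smooth_fun_on A W f \<longleftrightarrow> (\<forall>(U, \<phi>)\<in>A. smooth_on (\<phi> ` (U \<inter> W)) (f \<circ> inv_into U \<phi>))"

definition smooth_funs :: "('g::topological_space, 'n::finite) atlas \<Rightarrow> ('g \<Rightarrow> complex) set" where
  "smooth_funs A = {f. smooth_fun_on A UNIV f}"

definition lie_group ::
    "('g::{t2_space, second_countable_topology}) monoid \<Rightarrow> ('g, 'n::finite) atlas \<Rightarrow> bool" where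
  "lie_group G A \<longleftrightarrow>
     group G \<and> carrier G = UNIV \<and> smooth_atlas A \<and>
     continuous_on UNIV (\<lambda>(x, y). x \<otimes>\<^bsub>G\<^esub> y) \<and> continuous_on UNIV (\<lambda>x. inv\<^bsub>G\<^esub> x) \<and>
     (\<forall>(U, \<phi>)\<in>A. \<forall>(V, \<psi>)\<in>A. \<forall>(W, \<rho>)\<in>A.
        smooth_on {(\<phi> x, \<psi> y) |x y. x \<in> U \<and> y \<in> V \<and> x \<otimes>\<^bsub>G\<^esub> y \<in> W}
          (\<lambda>(u, v). \<rho> (inv_into U \<phi> u \<otimes>\<^bsub>G\<^esub> inv_into V \<psi> v))) \<and>
     (\<forall>(U, \<phi>)\<in>A. \<forall>(W, \<rho>)\<in>A.
        smooth_on {\<phi> x |x. x \<in> U \<and> inv\<^bsub>G\<^esub> x \<in> W} (\<lambda>u. \<rho> (inv\<^bsub>G\<^esub> (inv_into U \<phi> u))))"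


section \<open>Vector fields\<close>

text \<open>Sections of the complexified tangent bundle are the complex-linear derivations of the algebra
  of smooth complex-valued functions, extended by zero to non-smooth functions, so that equality of
  vector fields is equality of operators.  Real vector fields are those commuting with conjugation.
  Operations on vector fields are the pointwise ones of Function-Algebras.\<close>

type_synonym 'g vf = "('g \<Rightarrow> complex) \<Rightarrow> ('g \<Rightarrow> complex)"

definition vector_fields :: "('g::topological_space, 'n::finite) atlas \<Rightarrow> 'g vf set" where
  "vector_fields A =
     {X. (\<forall>f\<in>smooth_funs A. X f \<in> smooth_funs A) \<and> (\<forall>f. f \<notin> smooth_funs A \<longrightarrow> X f = 0) \<and>
         (\<forall>f\<in>smooth_funs A. \<forall>g\<in>smooth_funs A. X (f + g) = X f + X g) \<and>
         (\<forall>f\<in>smooth_funs A. \<forall>c. X ((\<lambda>_. c) * f) = (\<lambda>_. c) * X f) \<and>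
         (\<forall>f\<in>smooth_funs A. \<forall>g\<in>smooth_funs A. X (f * g) = X f * g + f * X g)}"

definition vscale :: "('g \<Rightarrow> complex) \<Rightarrow> 'g vf \<Rightarrow> 'g vf" where
  "vscale f X = (\<lambda>h. f * X h)"

definition bracket :: "'g vf \<Rightarrow> 'g vf \<Rightarrow> 'g vf" where
  "bracket X Y = (\<lambda>f. X (Y f) - Y (X f))"

definition conj_field :: "'g vf \<Rightarrow> 'g vf" where
  "conj_field X = (\<lambda>f x. cnj (X (\<lambda>y. cnj (f y)) x))"

definition real_fields :: "('g::topological_space, 'n::finite) atlas \<Rightarrow> 'g vf set" where
  "real_fields A = {X \<in> vector_fields A. conj_field X = X}"

text \<open>Push-forward under left translation by \<open>a\<close>.\<close>

definition pushforward :: "'g monoid \<Rightarrow> 'g \<Rightarrow> 'g vf \<Rightarrow> 'g vf" where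
  "pushforward G a X = (\<lambda>f x. X (\<lambda>y. f (a \<otimes>\<^bsub>G\<^esub> y)) (inv\<^bsub>G\<^esub> a \<otimes>\<^bsub>G\<^esub> x))"

definition lie_algebra ::
    "'g monoid \<Rightarrow> ('g::topological_space, 'n::finite) atlas \<Rightarrow> 'g vf set" where
  "lie_algebra G A = {X \<in> real_fields A. \<forall>a. pushforward G a X = X}"

definition almost_abelian ::
    "'g monoid \<Rightarrow> ('g::topological_space, 'n::finite) atlas \<Rightarrow> bool" where
  "almost_abelian G A \<longleftrightarrow>
     (\<exists>\<hh> \<subseteq> lie_algebra G A.
        0 \<in> \<hh> \<and> (\<forall>X\<in>\<hh>. \<forall>Y\<in>\<hh>. X + Y \<in> \<hh>) \<and>
        (\<forall>X\<in>\<hh>. \<forall>c::real. vscale (\<lambda>_. of_real c) X \<in> \<hh>) \<and>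
        (\<forall>X\<in>lie_algebra G A. \<forall>Y\<in>\<hh>. bracket X Y \<in> \<hh>) \<and>
        (\<forall>X\<in>\<hh>. \<forall>Y\<in>\<hh>. bracket X Y = 0) \<and>
        (\<exists>Y\<in>lie_algebra G A - \<hh>. \<forall>X\<in>lie_algebra G A.
           \<exists>c::real. \<exists>H\<in>\<hh>. X = vscale (\<lambda>_. of_real c) Y + H))"


section \<open>Differential forms\<close>

text \<open>A complex-valued \<open>k\<close>-form is evaluated on a list of \<open>k\<close> vector fields.  Its values on other
  arguments are irrelevant, so forms are compared with \<open>form_eq\<close>.\<close>

type_synonym 'g form = "'g vf list \<Rightarrow> 'g \<Rightarrow> complex"

definition field_lists :: "('g::topological_space, 'n::finite) atlas \<Rightarrow> nat \<Rightarrow> 'g vf list set" where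
  "field_lists A k = {Xs. length Xs = k \<and> set Xs \<subseteq> vector_fields A}"

definition form_eq ::
    "('g::topological_space, 'n::finite) atlas \<Rightarrow> nat \<Rightarrow> 'g form \<Rightarrow> 'g form \<Rightarrow> bool" where
  "form_eq A k \<alpha> \<beta> \<longleftrightarrow> (\<forall>Xs\<in>field_lists A k. \<alpha> Xs = \<beta> Xs)"

definition diff_form :: "('g::topological_space, 'n::finite) atlas \<Rightarrow> nat \<Rightarrow> 'g form \<Rightarrow> bool" where
  "diff_form A k \<alpha> \<longleftrightarrow>
     (\<forall>Xs\<in>field_lists A k.
        \<alpha> Xs \<in> smooth_funs A \<and>
        (\<forall>i<k. \<forall>Y\<in>vector_fields A. \<alpha> (Xs[i := Xs ! i + Y]) = \<alpha> Xs + \<alpha> (Xs[i := Y])) \<and>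
        (\<forall>i<k. \<forall>f\<in>smooth_funs A. \<alpha> (Xs[i := vscale f (Xs ! i)]) = f * \<alpha> Xs) \<and>
        (\<forall>i<k. \<forall>j<k. i \<noteq> j \<and> Xs ! i = Xs ! j \<longrightarrow> \<alpha> Xs = 0))"

definition real_form :: "('g::topological_space, 'n::finite) atlas \<Rightarrow> nat \<Rightarrow> 'g form \<Rightarrow> bool" where
  "real_form A k \<alpha> \<longleftrightarrow>
     (\<forall>Xs\<in>field_lists A k. set Xs \<subseteq> real_fields A \<longrightarrow> (\<forall>x. \<alpha> Xs x \<in> \<real>))"

definition conj_form :: "'g form \<Rightarrow> 'g form" where
  "conj_form \<alpha> = (\<lambda>Xs x. cnj (\<alpha> (map conj_field Xs) x))"

definition left_invariant_form ::
    "'g monoid \<Rightarrow> ('g::topological_space, 'n::finite) atlas \<Rightarrow> nat \<Rightarrow> 'g form \<Rightarrow> bool" where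
  "left_invariant_form G A k \<alpha> \<longleftrightarrow>
     (\<forall>a. \<forall>Xs\<in>field_lists A k. \<forall>x. \<alpha> (map (pushforward G a) Xs) (a \<otimes>\<^bsub>G\<^esub> x) = \<alpha> Xs x)"

text \<open>The convention is \<open>(\<alpha> \<and> \<beta>)(X,Y) = \<alpha>(X) \<beta>(Y) - \<alpha>(Y) \<beta>(X)\<close> for 1-forms; it matches the
  exterior derivative \<open>d\<alpha>(X,Y) = X \<alpha>(Y) - Y \<alpha>(X) - \<alpha>[X,Y]\<close>.\<close>

definition wedge :: "nat \<Rightarrow> nat \<Rightarrow> 'g form \<Rightarrow> 'g form \<Rightarrow> 'g form" where
  "wedge p q \<alpha> \<beta> = (\<lambda>Xs x.
     (\<Sum>\<pi> | \<pi> permutes {..<p+q}. of_int (sign \<pi>) *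
        \<alpha> (map (\<lambda>i. Xs ! \<pi> i) [0..<p]) x * \<beta> (map (\<lambda>i. Xs ! \<pi> i) [p..<p+q]) x)
     / (fact p * fact q))"

definition omit :: "nat \<Rightarrow> 'b list \<Rightarrow> 'b list" where
  "omit i xs = take i xs @ drop (Suc i) xs"

definition ext_deriv :: "'g form \<Rightarrow> 'g form" where
  "ext_deriv \<alpha> = (\<lambda>Xs x.
     (\<Sum>i<length Xs. (-1) ^ i * (Xs ! i) (\<alpha> (omit i Xs)) x) +
     (\<Sum>j<length Xs. \<Sum>i<j.
        (-1) ^ (i + j) * \<alpha> (bracket (Xs ! i) (Xs ! j) # omit i (omit j Xs)) x))"


section \<open>Hermitian and Kaehler structures\<close>

definition complex_structure ::
    "('g::topological_space, 'n::finite) atlas \<Rightarrow> ('g vf \<Rightarrow> 'g vf) \<Rightarrow> bool" where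
  "complex_structure A J \<longleftrightarrow>
     (\<forall>X\<in>vector_fields A. J X \<in> vector_fields A \<and> J (J X) = - X \<and>
        (\<forall>Y\<in>vector_fields A. J (X + Y) = J X + J Y) \<and>
        (\<forall>f\<in>smooth_funs A. J (vscale f X) = vscale f (J X))) \<and>
     (\<forall>X\<in>real_fields A. J X \<in> real_fields A) \<and>
     (\<forall>X\<in>vector_fields A. \<forall>Y\<in>vector_fields A.
        bracket X Y + J (bracket (J X) Y) + J (bracket X (J Y)) - bracket (J X) (J Y) = 0)"

definition left_invariant_endo ::
    "'g monoid \<Rightarrow> ('g::topological_space, 'n::finite) atlas \<Rightarrow> ('g vf \<Rightarrow> 'g vf) \<Rightarrow> bool" where
  "left_invariant_endo G A J \<longleftrightarrow>
     (\<forall>a. \<forall>X\<in>vector_fields A. J (pushforward G a X) = pushforward G a (J X))"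

definition fields_10 ::
    "('g::topological_space, 'n::finite) atlas \<Rightarrow> ('g vf \<Rightarrow> 'g vf) \<Rightarrow> 'g vf set" where
  "fields_10 A J = {Z \<in> vector_fields A. J Z = vscale (\<lambda>_. \<i>) Z}"

definition fields_01 ::
    "('g::topological_space, 'n::finite) atlas \<Rightarrow> ('g vf \<Rightarrow> 'g vf) \<Rightarrow> 'g vf set" where
  "fields_01 A J = {Z \<in> vector_fields A. J Z = vscale (\<lambda>_. - \<i>) Z}"

definition proj_10 :: "('g vf \<Rightarrow> 'g vf) \<Rightarrow> 'g vf \<Rightarrow> 'g vf" where
  "proj_10 J X = vscale (\<lambda>_. 1/2) (X - vscale (\<lambda>_. \<i>) (J X))"

definition proj_01 :: "('g vf \<Rightarrow> 'g vf) \<Rightarrow> 'g vf \<Rightarrow> 'g vf" where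
  "proj_01 J X = vscale (\<lambda>_. 1/2) (X + vscale (\<lambda>_. \<i>) (J X))"

text \<open>The \<open>(p,q)\<close>-component of a \<open>(p+q)\<close>-form, obtained by splitting each argument into its
  \<open>(1,0)\<close>- and \<open>(0,1)\<close>-part and keeping the terms with exactly \<open>p\<close> arguments of type \<open>(1,0)\<close>.
  The value type is arbitrary so as to include endomorphism-valued forms.\<close>

definition type_part :: "('g vf \<Rightarrow> 'g vf) \<Rightarrow> nat \<Rightarrow> nat \<Rightarrow> ('g vf list \<Rightarrow> 'b::comm_monoid_add) \<Rightarrow>
    'g vf list \<Rightarrow> 'b" where
  "type_part J p q \<alpha> = (\<lambda>Xs. \<Sum>S | S \<subseteq> {..<p+q} \<and> card S = p.
     \<alpha> (map (\<lambda>i. if i \<in> S then proj_10 J (Xs ! i) else proj_01 J (Xs ! i)) [0..<p+q]))"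

definition pq_form :: "('g::topological_space, 'n::finite) atlas \<Rightarrow> ('g vf \<Rightarrow> 'g vf) \<Rightarrow>
    nat \<Rightarrow> nat \<Rightarrow> 'g form \<Rightarrow> bool" where
  "pq_form A J p q \<alpha> \<longleftrightarrow> diff_form A (p+q) \<alpha> \<and> form_eq A (p+q) (type_part J p q \<alpha>) \<alpha>"

text \<open>Dolbeault operators on \<open>(p,q)\<close>-forms.\<close>

definition del :: "('g vf \<Rightarrow> 'g vf) \<Rightarrow> nat \<Rightarrow> nat \<Rightarrow> 'g form \<Rightarrow> 'g form" where
  "del J p q \<alpha> = type_part J (p+1) q (ext_deriv \<alpha>)"

definition delbar :: "('g vf \<Rightarrow> 'g vf) \<Rightarrow> nat \<Rightarrow> nat \<Rightarrow> 'g form \<Rightarrow> 'g form" where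
  "delbar J p q \<alpha> = type_part J p (q+1) (ext_deriv \<alpha>)"

text \<open>The metric of the fundamental form: \<open>g(X,Y) = \<omega>(X,JY)\<close>, that is \<open>\<omega>(X,Y) = g(JX,Y)\<close>; with this
  sign flat space has \<open>\<omega> = \<Sum> dx\<^sub>k \<and> dy\<^sub>k\<close> (where \<open>J \<partial>x\<^sub>k = \<partial>y\<^sub>k\<close>), and \<open>i \<Psi> \<and> cnj \<Psi>\<close> is a
  nonnegative multiple of \<open>\<omega>\<^sup>3\<close> for every \<open>(3,0)\<close>-form \<open>\<Psi>\<close>.\<close>

definition metric :: "('g vf \<Rightarrow> 'g vf) \<Rightarrow> 'g form \<Rightarrow> 'g vf \<Rightarrow> 'g vf \<Rightarrow> 'g \<Rightarrow> complex" where
  "metric J \<omega> X Y = \<omega> [X, J Y]"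

definition hermitian_structure :: "('g::topological_space, 'n::finite) atlas \<Rightarrow>
    ('g vf \<Rightarrow> 'g vf) \<Rightarrow> 'g form \<Rightarrow> bool" where
  "hermitian_structure A J \<omega> \<longleftrightarrow>
     complex_structure A J \<and> pq_form A J 1 1 \<omega> \<and> real_form A 2 \<omega> \<and>
     (\<forall>X\<in>real_fields A. \<forall>x. (\<exists>f. X f x \<noteq> 0) \<longrightarrow> Re (metric J \<omega> X X x) > 0)"

definition left_invariant_kaehler :: "'g monoid \<Rightarrow> ('g::topological_space, 'n::finite) atlas \<Rightarrow>
    ('g vf \<Rightarrow> 'g vf) \<Rightarrow> 'g form \<Rightarrow> bool" where
  "left_invariant_kaehler G A J \<omega> \<longleftrightarrow>
     hermitian_structure A J \<omega> \<and> left_invariant_endo G A J \<and> left_invariant_form G A 2 \<omega> \<and>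
     form_eq A 3 (ext_deriv \<omega>) 0"

definition holomorphic_volume_form :: "('g::topological_space, 'n::finite) atlas \<Rightarrow>
    ('g vf \<Rightarrow> 'g vf) \<Rightarrow> 'g form \<Rightarrow> bool" where
  "holomorphic_volume_form A J \<Psi> \<longleftrightarrow>
     pq_form A J 3 0 \<Psi> \<and> form_eq A 4 (delbar J 3 0 \<Psi>) 0 \<and>
     (\<forall>x. \<exists>Xs\<in>field_lists A 3. \<Psi> Xs x \<noteq> 0)"

definition form_norm :: "('g::topological_space, 'n::finite) atlas \<Rightarrow> 'g form \<Rightarrow> 'g form \<Rightarrow>
    'g \<Rightarrow> real" where
  "form_norm A \<omega> \<Psi> x = (THE r. r \<ge> 0 \<and> (\<forall>Xs\<in>field_lists A 6.
     of_real (r\<^sup>2) * (wedge 4 2 (wedge 2 2 \<omega> \<omega>) \<omega> Xs x / fact 3) =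
     \<i> * wedge 3 3 \<Psi> (conj_form \<Psi>) Xs x))"


section \<open>Gauduchon connections and their curvature\<close>

type_synonym 'g connection = "'g vf \<Rightarrow> 'g vf \<Rightarrow> 'g vf"

definition affine_connection ::
    "('g::topological_space, 'n::finite) atlas \<Rightarrow> 'g connection \<Rightarrow> bool" where
  "affine_connection A D \<longleftrightarrow>
     (\<forall>X\<in>vector_fields A. \<forall>Y\<in>vector_fields A.
        D X Y \<in> vector_fields A \<and>
        (\<forall>Z\<in>vector_fields A. D (X + Z) Y = D X Y + D Z Y \<and> D X (Y + Z) = D X Y + D X Z) \<and>
        (\<forall>f\<in>smooth_funs A. D (vscale f X) Y = vscale f (D X Y) \<and>
           D X (vscale f Y) = vscale (X f) Y + vscale f (D X Y))) \<and>
     (\<forall>X\<in>real_fields A. \<forall>Y\<in>real_fields A. D X Y \<in> real_fields A)"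

definition hermitian_connection :: "('g::topological_space, 'n::finite) atlas \<Rightarrow>
    ('g vf \<Rightarrow> 'g vf) \<Rightarrow> 'g form \<Rightarrow> 'g connection \<Rightarrow> bool" where
  "hermitian_connection A J \<omega> D \<longleftrightarrow>
     affine_connection A D \<and>
     (\<forall>X\<in>vector_fields A. \<forall>Y\<in>vector_fields A.
        D X (J Y) = J (D X Y) \<and>
        (\<forall>Z\<in>vector_fields A.
           X (metric J \<omega> Y Z) = metric J \<omega> (D X Y) Z + metric J \<omega> Y (D X Z)))"

definition torsion :: "'g connection \<Rightarrow> 'g vf \<Rightarrow> 'g vf \<Rightarrow> 'g vf" where
  "torsion D X Y = D X Y - D Y X - bracket X Y"

text \<open>The \<open>(0,1)\<close>-part of the Chern connection is the Dolbeault operator of the holomorphic tangent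
  bundle, \<open>W, Z \<mapsto> [W,Z]\<^sup>1\<^sup>,\<^sup>0\<close> for \<open>W\<close> of type \<open>(0,1)\<close> and \<open>Z\<close> of type \<open>(1,0)\<close>.\<close>

definition chern_connection :: "('g::topological_space, 'n::finite) atlas \<Rightarrow>
    ('g vf \<Rightarrow> 'g vf) \<Rightarrow> 'g form \<Rightarrow> 'g connection \<Rightarrow> bool" where
  "chern_connection A J \<omega> D \<longleftrightarrow>
     hermitian_connection A J \<omega> D \<and>
     (\<forall>W\<in>fields_01 A J. \<forall>Z\<in>fields_10 A J. D W Z = proj_10 J (bracket W Z))"

definition bismut_connection :: "('g::topological_space, 'n::finite) atlas \<Rightarrow>
    ('g vf \<Rightarrow> 'g vf) \<Rightarrow> 'g form \<Rightarrow> 'g connection \<Rightarrow> bool" where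
  "bismut_connection A J \<omega> D \<longleftrightarrow>
     hermitian_connection A J \<omega> D \<and>
     diff_form A 3 (\<lambda>Xs. metric J \<omega> (torsion D (Xs ! 0) (Xs ! 1)) (Xs ! 2))"

definition gauduchon_connection ::
    "'g connection \<Rightarrow> 'g connection \<Rightarrow> real \<Rightarrow> 'g connection" where
  "gauduchon_connection D_Ch D_B \<tau> = (\<lambda>X Y.
     vscale (\<lambda>_. of_real ((1 + \<tau>) / 2)) (D_Ch X Y) +
     vscale (\<lambda>_. of_real ((1 - \<tau>) / 2)) (D_B X Y))"

definition frame_expansion :: "('g::topological_space, 'n::finite) atlas \<Rightarrow> (nat \<Rightarrow> 'g vf) \<Rightarrow>
    'g vf \<Rightarrow> (nat \<Rightarrow> 'g \<Rightarrow> complex) \<Rightarrow> bool" where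
  "frame_expansion A e X c \<longleftrightarrow>
     (\<forall>i\<in>{1..6}. c i \<in> smooth_funs A) \<and> (\<forall>i. i \<notin> {1..6} \<longrightarrow> c i = 0) \<and>
     X = (\<Sum>i=1..6. vscale (c i) (e i))"

text \<open>A global frame is a basis of the module of vector fields over the smooth functions.\<close>

definition left_invariant_orthonormal_frame :: "'g monoid \<Rightarrow>
    ('g::topological_space, 'n::finite) atlas \<Rightarrow> ('g vf \<Rightarrow> 'g vf) \<Rightarrow> 'g form \<Rightarrow>
    (nat \<Rightarrow> 'g vf) \<Rightarrow> bool" where
  "left_invariant_orthonormal_frame G A J \<omega> e \<longleftrightarrow>
     (\<forall>i\<in>{1..6}. e i \<in> lie_algebra G A) \<and>
     (\<forall>X\<in>vector_fields A. \<exists>!c. frame_expansion A e X c) \<and>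
     (\<forall>i\<in>{1..6}. \<forall>j\<in>{1..6}. metric J \<omega> (e i) (e j) = (if i = j then 1 else 0))"

text \<open>\<open>conn_form A e D i j\<close> is \<open>\<sigma>\<^sup>i\<^sub>j\<close>.\<close>

definition conn_form :: "('g::topological_space, 'n::finite) atlas \<Rightarrow> (nat \<Rightarrow> 'g vf) \<Rightarrow>
    'g connection \<Rightarrow> nat \<Rightarrow> nat \<Rightarrow> 'g form" where
  "conn_form A e D i j = (\<lambda>Xs. (THE c. frame_expansion A e (D (Xs ! 0) (e j)) c) i)"

definition curv_form :: "('g::topological_space, 'n::finite) atlas \<Rightarrow> (nat \<Rightarrow> 'g vf) \<Rightarrow>
    'g connection \<Rightarrow> nat \<Rightarrow> nat \<Rightarrow> 'g form" where
  "curv_form A e D i j =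
     ext_deriv (conn_form A e D i j) +
     (\<Sum>k=1..6. wedge 1 1 (conn_form A e D i k) (conn_form A e D k j))"

definition tr_curv_sq :: "('g::topological_space, 'n::finite) atlas \<Rightarrow> (nat \<Rightarrow> 'g vf) \<Rightarrow>
    'g connection \<Rightarrow> 'g form" where
  "tr_curv_sq A e D =
     (\<Sum>j=1..6. \<Sum>i=1..<j. wedge 2 2 (curv_form A e D i j) (curv_form A e D i j))"


section \<open>Holomorphic vector bundles\<close>

text \<open>A complex vector bundle of rank \<open>r\<close> is a family \<open>E\<close> of subspaces of some complex vector space
  (with scalar multiplication \<open>scl\<close>, without topology) together with a set \<open>\<Phi>\<close> of local frames
  whose transition functions are holomorphic.  Any bundle is of this kind, e.g. inside the direct
  sum of its fibres.

  Vector fields act on global functions only; as they are local operators, a function \<open>h\<close> defined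
  near \<open>x\<close> is differentiated at \<open>x\<close> through global smooth functions that agree with \<open>h\<close> near \<open>x\<close>.\<close>

type_synonym ('g, 'v) local_frames = "('g set \<times> (nat \<Rightarrow> 'g \<Rightarrow> 'v)) set"

definition holomorphic_fun_on :: "('g::topological_space, 'n::finite) atlas \<Rightarrow>
    ('g vf \<Rightarrow> 'g vf) \<Rightarrow> 'g set \<Rightarrow> ('g \<Rightarrow> complex) \<Rightarrow> bool" where
  "holomorphic_fun_on A J W h \<longleftrightarrow>
     smooth_fun_on A W h \<and>
     (\<forall>x\<in>W. \<forall>f\<in>smooth_funs A. (\<forall>\<^sub>F y in nhds x. f y = h y) \<longrightarrow>
        (\<forall>Z\<in>fields_01 A J. Z f x = 0))"

definition holomorphic_bundle :: "('g::topological_space, 'n::finite) atlas \<Rightarrow>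
    ('g vf \<Rightarrow> 'g vf) \<Rightarrow> (complex \<Rightarrow> 'v::ab_group_add \<Rightarrow> 'v) \<Rightarrow> nat \<Rightarrow> ('g \<Rightarrow> 'v set) \<Rightarrow>
    ('g, 'v) local_frames \<Rightarrow> bool" where
  "holomorphic_bundle A J scl r E \<Phi> \<longleftrightarrow>
     vector_space scl \<and>
     (\<Union>(U, b)\<in>\<Phi>. U) = UNIV \<and>
     (\<forall>(U, b)\<in>\<Phi>. open U \<and>
        (\<forall>x\<in>U. inj_on (\<lambda>i. b i x) {..<r} \<and>
           \<not> module.dependent scl ((\<lambda>i. b i x) ` {..<r}) \<and>
           module.span scl ((\<lambda>i. b i x) ` {..<r}) = E x)) \<and>
     (\<forall>(U, b)\<in>\<Phi>. \<forall>(U', b')\<in>\<Phi>. \<exists>h.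
        (\<forall>i<r. \<forall>j<r. holomorphic_fun_on A J (U \<inter> U') (h i j)) \<and>
        (\<forall>x\<in>U \<inter> U'. \<forall>j<r. b' j x = (\<Sum>i<r. scl (h i j x) (b i x))))"

definition smooth_sections :: "('g::topological_space, 'n::finite) atlas \<Rightarrow>
    (complex \<Rightarrow> 'v::ab_group_add \<Rightarrow> 'v) \<Rightarrow> nat \<Rightarrow> ('g \<Rightarrow> 'v set) \<Rightarrow> ('g, 'v) local_frames \<Rightarrow>
    ('g \<Rightarrow> 'v) set" where
  "smooth_sections A scl r E \<Phi> =
     {s. (\<forall>x. s x \<in> E x) \<and>
         (\<forall>(U, b)\<in>\<Phi>. \<exists>c. (\<forall>i<r. smooth_fun_on A U (c i)) \<and>
            (\<forall>x\<in>U. s x = (\<Sum>i<r. scl (c i x) (b i x))))}"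

text \<open>A connection on \<open>E\<close> whose \<open>(0,1)\<close>-part is the Dolbeault operator of the holomorphic
  structure, which annihilates the local holomorphic frames.\<close>

definition compatible_bundle_connection :: "('g::topological_space, 'n::finite) atlas \<Rightarrow>
    ('g vf \<Rightarrow> 'g vf) \<Rightarrow> (complex \<Rightarrow> 'v::ab_group_add \<Rightarrow> 'v) \<Rightarrow> nat \<Rightarrow> ('g \<Rightarrow> 'v set) \<Rightarrow>
    ('g, 'v) local_frames \<Rightarrow> ('g vf \<Rightarrow> ('g \<Rightarrow> 'v) \<Rightarrow> ('g \<Rightarrow> 'v)) \<Rightarrow> bool" where
  "compatible_bundle_connection A J scl r E \<Phi> D \<longleftrightarrow>
     (\<forall>X\<in>vector_fields A. \<forall>s\<in>smooth_sections A scl r E \<Phi>.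
        D X s \<in> smooth_sections A scl r E \<Phi> \<and>
        (\<forall>Y\<in>vector_fields A. D (X + Y) s = D X s + D Y s) \<and>
        (\<forall>t\<in>smooth_sections A scl r E \<Phi>. D X (s + t) = D X s + D X t) \<and>
        (\<forall>f\<in>smooth_funs A.
           D (vscale f X) s = (\<lambda>x. scl (f x) (D X s x)) \<and>
           D X (\<lambda>x. scl (f x) (s x)) = (\<lambda>x. scl (X f x) (s x) + scl (f x) (D X s x)))) \<and>
     (\<forall>W\<in>fields_01 A J. \<forall>s\<in>smooth_sections A scl r E \<Phi>. \<forall>(U, b)\<in>\<Phi>. \<forall>x\<in>U. \<forall>f.
        (\<forall>i<r. f i \<in> smooth_funs A) \<and>
        (\<forall>\<^sub>F y in nhds x. s y = (\<Sum>i<r. scl (f i y) (b i y))) \<longrightarrow>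
        D W s x = (\<Sum>i<r. scl (W (f i) x) (b i x)))"

text \<open>Forms with values in the endomorphisms of \<open>E\<close> are represented by their action on the smooth
  sections \<open>\<Gamma>\<close>, extended by zero to other maps.\<close>

type_synonym ('g, 'v) endo_form = "'g vf list \<Rightarrow> ('g \<Rightarrow> 'v) \<Rightarrow> ('g \<Rightarrow> 'v)"

definition bundle_curvature :: "('g \<Rightarrow> 'v::ab_group_add) set \<Rightarrow>
    ('g vf \<Rightarrow> ('g \<Rightarrow> 'v) \<Rightarrow> ('g \<Rightarrow> 'v)) \<Rightarrow> ('g, 'v) endo_form" where
  "bundle_curvature \<Gamma> D = (\<lambda>Xs s. if s \<in> \<Gamma> then
     D (Xs ! 0) (D (Xs ! 1) s) - D (Xs ! 1) (D (Xs ! 0) s) - D (bracket (Xs ! 0) (Xs ! 1)) s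
     else 0)"

definition endo_form_zero :: "('g::topological_space, 'n::finite) atlas \<Rightarrow>
    ('g \<Rightarrow> 'v::ab_group_add) set \<Rightarrow> nat \<Rightarrow> ('g, 'v) endo_form \<Rightarrow> bool" where
  "endo_form_zero A \<Gamma> k F \<longleftrightarrow> (\<forall>Xs\<in>field_lists A k. \<forall>s\<in>\<Gamma>. F Xs s = 0)"

definition wedge_endo :: "(complex \<Rightarrow> 'v::ab_group_add \<Rightarrow> 'v) \<Rightarrow> nat \<Rightarrow> nat \<Rightarrow> 'g form \<Rightarrow>
    ('g, 'v) endo_form \<Rightarrow> ('g, 'v) endo_form" where
  "wedge_endo scl p q \<alpha> F = (\<lambda>Xs s x. scl (1 / (fact p * fact q))
     (\<Sum>\<pi> | \<pi> permutes {..<p+q}.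
        scl (of_int (sign \<pi>) * \<alpha> (map (\<lambda>i. Xs ! \<pi> i) [0..<p]) x)
          (F (map (\<lambda>i. Xs ! \<pi> i) [p..<p+q]) s x)))"

definition endo_wedge_endo :: "(complex \<Rightarrow> 'v::ab_group_add \<Rightarrow> 'v) \<Rightarrow> nat \<Rightarrow> nat \<Rightarrow>
    ('g, 'v) endo_form \<Rightarrow> ('g, 'v) endo_form \<Rightarrow> ('g, 'v) endo_form" where
  "endo_wedge_endo scl p q F H = (\<lambda>Xs s x. scl (1 / (fact p * fact q))
     (\<Sum>\<pi> | \<pi> permutes {..<p+q}.
        scl (of_int (sign \<pi>))
          (F (map (\<lambda>i. Xs ! \<pi> i) [0..<p]) (H (map (\<lambda>i. Xs ! \<pi> i) [p..<p+q]) s) x)))"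

text \<open>An endomorphism of \<open>E\<close>, given by its action \<open>P\<close> on sections, maps \<open>v \<in> E x\<close> to \<open>P s x\<close> for any
  section \<open>s\<close> with \<open>s x = v\<close>; the trace is taken in any basis of \<open>E x\<close>.\<close>

definition fibre_endo :: "('g \<Rightarrow> 'v) set \<Rightarrow> (('g \<Rightarrow> 'v) \<Rightarrow> ('g \<Rightarrow> 'v)) \<Rightarrow> 'g \<Rightarrow> 'v \<Rightarrow> 'v" where
  "fibre_endo \<Gamma> P x v = P (SOME s. s \<in> \<Gamma> \<and> s x = v) x"

definition trace_form :: "(complex \<Rightarrow> 'v::ab_group_add \<Rightarrow> 'v) \<Rightarrow> ('g \<Rightarrow> 'v set) \<Rightarrow>
    ('g \<Rightarrow> 'v) set \<Rightarrow> ('g, 'v) endo_form \<Rightarrow> 'g form" where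
  "trace_form scl E \<Gamma> F = (\<lambda>Xs x.
     let B = (SOME B. \<not> module.dependent scl B \<and> module.span scl B = E x)
     in \<Sum>b\<in>B. module.representation scl B (fibre_endo \<Gamma> (F Xs) x b) b)"

end

theory Submission
  imports Defs
begin

text \<open>
  Every term of the first three equations vanishes separately, and in the last equation the norm of
  \<open>\<Psi>\<close> is a constant factor.

  \<^item> The terms with \<open>F\<close>, including the trace of \<open>F \<and> F\<close>, vanish because \<open>F\<close> does. The second
    derivative of \<open>\<omega>\<close> on the left-hand side of the anomaly equation vanishes because \<open>d\<omega>\<close> does.

  \<^item> The norm of \<open>\<Psi>\<close> is invariant under left translations, hence constant, and
    \<open>d(\<omega> \<and> \<omega>) = 2 d\<omega> \<and> \<omega> = 0\<close> (lemmas \<open>form_norm_constant\<close>, \<open>closed_square\<close>).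

  \<^item> On a Kaehler manifold a Hermitian connection has little room for torsion: parallelism of \<open>\<omega>\<close>
    and of \<open>J\<close> turns \<open>d\<omega> = 0\<close> and the integrability of \<open>J\<close> into linear equations for the torsion.
    With the defining property of the Chern or of the Bismut connection these force the torsion to
    vanish. So both connections, and every Gauduchon connection, are the Levi-Civita connection
    (\<open>gauduchon_levi_civita\<close>).

  \<^item> It remains to see that \<open>tr (\<Omega> \<and> \<Omega>) = 0\<close> for the Levi-Civita connection \<open>D\<close>. Let \<open>N\<close> be a unit
    normal of the abelian ideal and \<open>M = J N\<close>, which lies in the ideal. By the Koszul formula \<open>D X Y\<close>
    is normal to the ideal for \<open>X\<close> and \<open>Y\<close> in it. If \<open>Y\<close> is also orthogonal to \<open>M\<close>, then \<open>J Y\<close> lies in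
    the ideal too, so \<open>D X Y\<close> is at once parallel to \<open>N\<close> and, being \<open>-J (D X (J Y))\<close>, to \<open>M\<close>; it is
    therefore zero. It follows that \<open>D Y\<close> annihilates the Lie algebra for such \<open>Y\<close>, and that the
    curvature vanishes as soon as one of its two form arguments is orthogonal to \<open>N\<close> and \<open>M\<close>:
    geometrically, the group is locally the product of a flat factor and a surface. Each curvature form is thus a
    multiple of the area form of the plane of \<open>N\<close> and \<open>M\<close>, and the square of this decomposable form
    is zero, already for each pair of indices (\<open>curvature_form_square\<close>).

  As vector fields are derivations of the algebra of smooth functions, the calculus of smooth maps is
  needed first, to show that these functions form an algebra that is stable under conjugation and
  under left translations.
\<close>

section \<open>Calculus of smooth maps between Euclidean spaces\<close>

lemma k_smooth_on_cong:
  assumes "open U" and "\<And>x. x \<in> U \<Longrightarrow> f x = g x"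
  shows "k_smooth_on k U f \<longleftrightarrow> k_smooth_on k U g"
  using assms(2)
proof (induction k arbitrary: f g)
  case 0
  then show ?case by (auto cong: continuous_on_cong)
next
  case (Suc k)
  have d: "(f has_derivative D) (at x) \<longleftrightarrow> (g has_derivative D) (at x)" if "x \<in> U" for x D
    using has_derivative_transform_within_open[OF _ assms(1) that, of f D UNIV g]
      has_derivative_transform_within_open[OF _ assms(1) that, of g D UNIV f] Suc.prems
    by auto
  have fd: "frechet_derivative f (at x) = frechet_derivative g (at x)" if "x \<in> U" for x
    using d[OF that] by (simp add: frechet_derivative_def)
  have "k_smooth_on k U (\<lambda>x. frechet_derivative f (at x) v) \<longleftrightarrow>
        k_smooth_on k U (\<lambda>x. frechet_derivative g (at x) v)" for v
    by (rule Suc.IH) (simp add: fd)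
  moreover have "f differentiable (at x) \<longleftrightarrow> g differentiable (at x)" if "x \<in> U" for x
    using d[OF that] by (simp add: differentiable_def)
  ultimately show ?case by auto
qed

text \<open>Derivatives found by differentiation rules may replace the chosen Frechet derivative.\<close>

lemma k_smooth_on_Suc_I:
  assumes "open U" and "\<And>x. x \<in> U \<Longrightarrow> (f has_derivative D x) (at x)"
    and "\<And>v. k_smooth_on k U (\<lambda>x. D x v)"
  shows "k_smooth_on (Suc k) U f"
proof -
  have "k_smooth_on k U (\<lambda>x. frechet_derivative f (at x) v)" for v
  proof (rule k_smooth_on_cong[THEN iffD2, OF assms(1) _ assms(3)])
    show "frechet_derivative f (at x) v = D x v" if "x \<in> U" for x
      using frechet_derivative_at[OF assms(2)[OF that]] by simp
  qed
  then show ?thesis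
    using assms(2) by (auto simp: differentiable_def)
qed

lemma k_smooth_on_SucD:
  assumes "k_smooth_on (Suc k) U f" "x \<in> U"
  shows "(f has_derivative frechet_derivative f (at x)) (at x)"
  using assms frechet_derivative_works by auto

lemma k_smooth_on_lower: "k_smooth_on (Suc k) U f \<Longrightarrow> k_smooth_on k U f"
proof (induction k arbitrary: f)
  case 0
  then have "\<forall>x\<in>U. f differentiable (at x)" by simp
  then show ?case
    by (auto intro!: continuous_at_imp_continuous_on differentiable_imp_continuous_within)
next
  case (Suc k)
  show ?case
    unfolding k_smooth_on.simps(2)[of k]
    using Suc.prems Suc.IH by (metis k_smooth_on.simps(2))
qed

lemma k_smooth_on_const: "open U \<Longrightarrow> k_smooth_on k U (\<lambda>_. c)"
proof (induction k arbitrary: c)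
  case (Suc k)
  show ?case
    by (rule k_smooth_on_Suc_I[where D="\<lambda>_ _. 0"]) (use Suc in auto)
qed simp

lemma k_smooth_on_add:
  assumes "open U"
  shows "k_smooth_on k U f \<Longrightarrow> k_smooth_on k U g \<Longrightarrow> k_smooth_on k U (\<lambda>x. f x + g x)"
proof (induction k arbitrary: f g)
  case (Suc k)
  show ?case
    by (rule k_smooth_on_Suc_I[OF assms has_derivative_add[OF k_smooth_on_SucD[OF Suc.prems(1)]
            k_smooth_on_SucD[OF Suc.prems(2)]]]) (use Suc in auto)
qed (auto intro: continuous_on_add)

lemma k_smooth_on_sum:
  assumes "open U" "\<And>i. i \<in> I \<Longrightarrow> k_smooth_on k U (f i)"
  shows "k_smooth_on k U (\<lambda>x. \<Sum>i\<in>I. f i x)"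
  using assms(2)
  by (induction I rule: infinite_finite_induct)
     (auto intro: k_smooth_on_add k_smooth_on_const assms(1))

lemma k_smooth_on_linear:
  assumes "open U" "bounded_linear h"
  shows "k_smooth_on k U f \<Longrightarrow> k_smooth_on k U (\<lambda>x. h (f x))"
proof (induction k arbitrary: f)
  case 0
  then show ?case
    using assms(2) by (auto intro: bounded_linear.continuous_on)
next
  case (Suc k)
  show ?case
    by (rule k_smooth_on_Suc_I[OF assms(1) bounded_linear.has_derivative[OF assms(2)
            k_smooth_on_SucD[OF Suc.prems]]]) (use Suc in auto)
qed

lemma k_smooth_on_bilinear:
  assumes "open U" "bounded_bilinear h"
  shows "k_smooth_on k U f \<Longrightarrow> k_smooth_on k U g \<Longrightarrow> k_smooth_on k U (\<lambda>x. h (f x) (g x))"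
proof (induction k arbitrary: f g)
  case 0
  then show ?case
    using assms(2) by (auto intro: bounded_bilinear.continuous_on)
next
  case (Suc k)
  note lower = Suc.prems[THEN k_smooth_on_lower]
  show ?case
  proof (rule k_smooth_on_Suc_I[OF assms(1) bounded_bilinear.FDERIV[OF assms(2)
            k_smooth_on_SucD[OF Suc.prems(1)] k_smooth_on_SucD[OF Suc.prems(2)]]])
    fix v
    show "k_smooth_on k U (\<lambda>x. h (f x) (frechet_derivative g (at x) v) +
            h (frechet_derivative f (at x) v) (g x))"
      using Suc by (intro k_smooth_on_add assms(1) Suc.IH lower) auto
  qed
qed

text \<open>The chain rule expresses a directional derivative of \<open>g \<circ> f\<close> as a sum, over the standard
  basis, of products of directional derivatives of \<open>f\<close> and of \<open>g\<close>, which keeps the induction on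
  the order of differentiability within the stated class.\<close>

lemma k_smooth_on_compose:
  fixes f :: "'a::euclidean_space \<Rightarrow> 'b::euclidean_space" and g :: "'b \<Rightarrow> 'c::real_normed_vector"
  assumes "open U" "f ` U \<subseteq> V"
  shows "k_smooth_on k U f \<Longrightarrow> k_smooth_on k V g \<Longrightarrow> k_smooth_on k U (\<lambda>x. g (f x))"
proof (induction k arbitrary: g)
  case 0
  then show ?case using assms(2) by (auto intro: continuous_on_compose2)
next
  case (Suc k)
  let ?D = "\<lambda>x v. \<Sum>b\<in>Basis. (frechet_derivative f (at x) v \<bullet> b) *\<^sub>R
                    frechet_derivative g (at (f x)) b"
  have D: "((\<lambda>x. g (f x)) has_derivative ?D x) (at x)" if "x \<in> U" for x
  proof -
    have f: "(f has_derivative frechet_derivative f (at x)) (at x)"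
      by (rule k_smooth_on_SucD[OF Suc.prems(1) that])
    have g: "(g has_derivative frechet_derivative g (at (f x))) (at (f x))"
      using k_smooth_on_SucD[OF Suc.prems(2)] that assms(2) by auto
    have l: "linear (frechet_derivative g (at (f x)))"
      using g has_derivative_linear by blast
    have "frechet_derivative g (at (f x)) w = (\<Sum>b\<in>Basis. (w \<bullet> b) *\<^sub>R frechet_derivative g (at (f x)) b)"
      for w
      using linear_sum[OF l, of "\<lambda>b. (w \<bullet> b) *\<^sub>R b" Basis] linear_scale[OF l]
      by (simp add: euclidean_representation)
    then have "(\<lambda>v. frechet_derivative g (at (f x)) (frechet_derivative f (at x) v)) = ?D x"
      by blast
    then show ?thesis
      using has_derivative_compose[OF f g] by simp
  qed
  show ?case
  proof (rule k_smooth_on_Suc_I[OF assms(1) D])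
    fix v
    have "k_smooth_on k U (\<lambda>x. frechet_derivative f (at x) v)"
      and "k_smooth_on k V (\<lambda>x. frechet_derivative g (at x) b)" for b
      using Suc.prems by simp_all
    then show "k_smooth_on k U (\<lambda>x. ?D x v)"
      by (intro k_smooth_on_sum k_smooth_on_bilinear[OF _ bounded_bilinear_scaleR] assms(1)
          k_smooth_on_linear[OF _ bounded_linear_inner_left]
          Suc.IH[OF k_smooth_on_lower[OF Suc.prems(1)]])
  qed
qed

lemma k_smooth_on_local:
  assumes "\<And>x. x \<in> U \<Longrightarrow> \<exists>O'. open O' \<and> x \<in> O' \<and> k_smooth_on k O' f"
  shows "k_smooth_on k U f"
  using assms
proof (induction k arbitrary: f)
  case 0
  show ?case
    unfolding k_smooth_on.simps
  proof (intro continuous_at_imp_continuous_on ballI)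
    fix x assume "x \<in> U"
    then show "isCont f x"
      using 0[of x] by (auto simp: continuous_on_eq_continuous_at)
  qed
next
  case (Suc k)
  show ?case
    unfolding k_smooth_on.simps
  proof (intro conjI ballI allI)
    fix v show "k_smooth_on k U (\<lambda>x. frechet_derivative f (at x) v)"
      using Suc.prems unfolding k_smooth_on.simps by (intro Suc.IH) blast
  next
    fix x assume "x \<in> U"
    then show "f differentiable (at x)"
      using Suc.prems[of x] by auto
  qed
qed

lemma k_smooth_on_slice:
  assumes "open U" shows "k_smooth_on k U (\<lambda>v. (c, v))"
proof (cases k)
  case (Suc m)
  show ?thesis
    unfolding Suc
    by (rule k_smooth_on_Suc_I[OF assms, where D="\<lambda>_ v. (0, v)"])
       (auto intro!: derivative_eq_intros k_smooth_on_const assms)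
qed (auto intro!: continuous_intros)

section \<open>The algebra of smooth functions\<close>

lemma smooth_funs_iff:
  "f \<in> smooth_funs A \<longleftrightarrow> (\<forall>(U, \<phi>)\<in>A. smooth_on (\<phi> ` U) (\<lambda>u. f (inv_into U \<phi> u)))"
  by (simp add: smooth_funs_def smooth_fun_on_def o_def)

locale manifold =
  fixes A :: "('g::topological_space, 'n::finite) atlas"
  assumes atlas: "smooth_atlas A"
begin

abbreviation "\<C> \<equiv> smooth_funs A"
abbreviation "\<V> \<equiv> vector_fields A"

lemma chart_open: "(U, \<phi>) \<in> A \<Longrightarrow> open (\<phi> ` U)"
  using atlas by (force simp: smooth_atlas_def)

lemma chart_cover: "\<exists>U \<phi>. (U, \<phi>) \<in> A \<and> x \<in> U"
proof -
  have "(\<Union>(U, \<phi>)\<in>A. U) = UNIV" using atlas by (simp add: smooth_atlas_def)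
  then have "x \<in> (\<Union>(U, \<phi>)\<in>A. U)" by simp
  then show ?thesis by auto
qed

lemma chart_homeomorphism: "(U, \<phi>) \<in> A \<Longrightarrow> homeomorphism U (\<phi> ` U) \<phi> (inv_into U \<phi>)"
  using atlas by (force simp: smooth_atlas_def)

lemma chart_inverse: "(U, \<phi>) \<in> A \<Longrightarrow> x \<in> U \<Longrightarrow> inv_into U \<phi> (\<phi> x) = x"
  using chart_homeomorphism by (simp add: homeomorphism_def)

lemma smooth_const [simp]: "(\<lambda>_. c) \<in> \<C>"
  by (auto simp: smooth_funs_iff smooth_on_def intro!: k_smooth_on_const chart_open)

lemma smooth_zero [simp]: "0 \<in> \<C>"
  using smooth_const[of 0] by (simp add: zero_fun_def)

lemma smooth_add [simp]: "f \<in> \<C> \<Longrightarrow> g \<in> \<C> \<Longrightarrow> f + g \<in> \<C>"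
  by (fastforce simp: smooth_funs_iff smooth_on_def intro!: k_smooth_on_add chart_open)

lemma smooth_mult [simp]: "f \<in> \<C> \<Longrightarrow> g \<in> \<C> \<Longrightarrow> f * g \<in> \<C>"
  by (fastforce simp: smooth_funs_iff smooth_on_def
      intro!: k_smooth_on_bilinear[OF _ bounded_bilinear_mult] chart_open)

lemma smooth_uminus [simp]: "f \<in> \<C> \<Longrightarrow> - f \<in> \<C>"
  using smooth_mult[of "\<lambda>_. -1" f] by (simp add: times_fun_def fun_Compl_def)

lemma smooth_diff [simp]: "f \<in> \<C> \<Longrightarrow> g \<in> \<C> \<Longrightarrow> f - g \<in> \<C>"
  using smooth_add[of f "- g"] by simp

lemma smooth_cnj [simp]: "f \<in> \<C> \<Longrightarrow> (\<lambda>x. cnj (f x)) \<in> \<C>"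
  by (fastforce simp: smooth_funs_iff smooth_on_def
      intro!: k_smooth_on_linear[OF _ bounded_linear_cnj] chart_open)

end

locale lie_group_manifold =
  fixes G :: "('g::{t2_space, second_countable_topology}) monoid" and A :: "('g, 'n::finite) atlas"
  assumes lie_group: "lie_group G A"

sublocale lie_group_manifold \<subseteq> manifold A
  by standard (use lie_group in \<open>simp add: lie_group_def\<close>)

context lie_group_manifold
begin

sublocale group G
  using lie_group by (simp add: lie_group_def)

lemma carrier_UNIV [simp]: "carrier G = UNIV"
  using lie_group by (simp add: lie_group_def)

lemma inv_mult_cancel [simp]: "inv\<^bsub>G\<^esub> a \<otimes>\<^bsub>G\<^esub> (a \<otimes>\<^bsub>G\<^esub> x) = x" "a \<otimes>\<^bsub>G\<^esub> (inv\<^bsub>G\<^esub> a \<otimes>\<^bsub>G\<^esub> x) = x"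
  by (simp_all add: m_assoc[symmetric])

text \<open>In charts, a left translation is a slice of the multiplication map.\<close>

lemma smooth_translate:
  assumes f: "f \<in> \<C>"
  shows "(\<lambda>y. f (a \<otimes>\<^bsub>G\<^esub> y)) \<in> \<C>"
  unfolding smooth_funs_iff
proof safe
  fix V \<psi> assume V: "(V, \<psi>) \<in> A"
  have oV: "open V"
    using atlas V by (auto simp: smooth_atlas_def)
  show "smooth_on (\<psi> ` V) (\<lambda>u. f (a \<otimes>\<^bsub>G\<^esub> inv_into V \<psi> u))"
    unfolding smooth_on_def
  proof (intro allI k_smooth_on_local)
    fix k v assume "v \<in> \<psi> ` V"
    then obtain y where y: "y \<in> V" "v = \<psi> y" by blast
    obtain U \<phi> where U: "(U, \<phi>) \<in> A" "a \<in> U" using chart_cover by blast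
    obtain W \<rho> where W: "(W, \<rho>) \<in> A" "a \<otimes>\<^bsub>G\<^esub> y \<in> W" using chart_cover by blast
    have oW: "open W" using atlas W by (auto simp: smooth_atlas_def)
    define Q where "Q = V \<inter> (\<lambda>z. a \<otimes>\<^bsub>G\<^esub> z) -` W"
    have "continuous_on UNIV (\<lambda>(x, y). x \<otimes>\<^bsub>G\<^esub> y)"
      using lie_group by (simp add: lie_group_def)
    then have "continuous_on UNIV (\<lambda>z. (\<lambda>(x, y). x \<otimes>\<^bsub>G\<^esub> y) (a, z))"
      by (rule continuous_on_compose2) (auto intro!: continuous_intros)
    then have "open ((\<lambda>z. a \<otimes>\<^bsub>G\<^esub> z) -` W)"
      using oW by (simp add: open_vimage)
    then have "open Q" using oV by (auto simp: Q_def)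
    then have "openin (top_of_set (\<psi> ` V)) (\<psi> ` Q)"
      by (intro homeomorphism_imp_open_map[OF chart_homeomorphism[OF V]]) (auto simp: Q_def intro: open_subset)
    then have oQ: "open (\<psi> ` Q)"
      using chart_open[OF V] by (simp add: openin_open_eq)
    let ?S = "{(\<phi> x, \<psi> y) |x y. x \<in> U \<and> y \<in> V \<and> x \<otimes>\<^bsub>G\<^esub> y \<in> W}"
    have "smooth_on ?S (\<lambda>(u, v). \<rho> (inv_into U \<phi> u \<otimes>\<^bsub>G\<^esub> inv_into V \<psi> v))"
      using lie_group U V W unfolding lie_group_def by fast
    then have m: "k_smooth_on k ?S (\<lambda>(u, v). \<rho> (inv_into U \<phi> u \<otimes>\<^bsub>G\<^esub> inv_into V \<psi> v))"
      by (simp add: smooth_on_def)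
    have "k_smooth_on k (\<psi> ` Q)
            (\<lambda>v. (\<lambda>(u, v). \<rho> (inv_into U \<phi> u \<otimes>\<^bsub>G\<^esub> inv_into V \<psi> v)) (\<phi> a, v))"
      by (rule k_smooth_on_compose[OF oQ _ k_smooth_on_slice[OF oQ] m]) (use U in \<open>auto simp: Q_def\<close>)
    then have l: "k_smooth_on k (\<psi> ` Q) (\<lambda>v. \<rho> (a \<otimes>\<^bsub>G\<^esub> inv_into V \<psi> v))"
      by (simp add: chart_inverse[OF U])
    have fk: "k_smooth_on k (\<rho> ` W) (\<lambda>u. f (inv_into W \<rho> u))"
      using f W by (auto simp: smooth_funs_iff smooth_on_def)
    have "k_smooth_on k (\<psi> ` Q) (\<lambda>v. f (inv_into W \<rho> (\<rho> (a \<otimes>\<^bsub>G\<^esub> inv_into V \<psi> v))))"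
      by (rule k_smooth_on_compose[OF oQ _ l fk]) (auto simp: Q_def chart_inverse[OF V])
    then have "k_smooth_on k (\<psi> ` Q) (\<lambda>v. f (a \<otimes>\<^bsub>G\<^esub> inv_into V \<psi> v))"
      by (rule k_smooth_on_cong[THEN iffD1, OF oQ, rotated]) (auto simp: Q_def chart_inverse[OF V] chart_inverse[OF W(1)])
    then show "\<exists>O'. open O' \<and> v \<in> O' \<and> k_smooth_on k O' (\<lambda>u. f (a \<otimes>\<^bsub>G\<^esub> inv_into V \<psi> u))"
      using oQ y W by (auto simp: Q_def)
  qed
qed

lemma smooth_translate_iff: "(\<lambda>y. f (a \<otimes>\<^bsub>G\<^esub> y)) \<in> \<C> \<longleftrightarrow> f \<in> \<C>"
  using smooth_translate[of f a] smooth_translate[of "\<lambda>y. f (a \<otimes>\<^bsub>G\<^esub> y)" "inv\<^bsub>G\<^esub> a"] by auto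

end

section \<open>Vector fields\<close>

text \<open>All algebra with vector fields takes place in the module of operators on functions, where the
  scalars are arbitrary functions; smoothness only matters for membership.\<close>

interpretation vf: module "vscale :: ('g \<Rightarrow> complex) \<Rightarrow> 'g vf \<Rightarrow> 'g vf"
  by standard (auto simp: vscale_def fun_eq_iff algebra_simps)

lemma vscale_const_mult: "vscale (\<lambda>_. a) (vscale (\<lambda>_. b) X) = vscale (\<lambda>_. a * b) X"
  by (simp add: vscale_def fun_eq_iff)

lemma vscale_const_one [simp]: "vscale (\<lambda>_. 1) X = X"
  by (simp add: vscale_def fun_eq_iff)

lemma bracket_swap: "bracket Y X = - bracket X Y"
  by (simp add: bracket_def fun_eq_iff)

lemma conj_conj [simp]: "conj_field (conj_field X) = X"
  by (simp add: conj_field_def)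

lemma conj_add: "conj_field (X + Y) = conj_field X + conj_field Y"
  by (simp add: conj_field_def fun_eq_iff)

lemma conj_diff: "conj_field (X - Y) = conj_field X - conj_field Y"
  by (simp add: conj_field_def fun_eq_iff)

lemma conj_vscale: "conj_field (vscale f X) = vscale (\<lambda>x. cnj (f x)) (conj_field X)"
  by (simp add: conj_field_def vscale_def fun_eq_iff)

lemma vscale_apply: "vscale f X h = f * X h"
  by (simp add: vscale_def)

context manifold
begin

lemma vector_fieldsD:
  assumes "X \<in> \<V>"
  shows "f \<in> \<C> \<Longrightarrow> X f \<in> \<C>" and field_nonsmooth: "f \<notin> \<C> \<Longrightarrow> X f = 0"
    and field_add: "f \<in> \<C> \<Longrightarrow> g \<in> \<C> \<Longrightarrow> X (f + g) = X f + X g"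
    and field_const_mult: "f \<in> \<C> \<Longrightarrow> X ((\<lambda>_. c) * f) = (\<lambda>_. c) * X f"
    and field_mult: "f \<in> \<C> \<Longrightarrow> g \<in> \<C> \<Longrightarrow> X (f * g) = X f * g + f * X g"
  using assms unfolding vector_fields_def by blast+

lemma field_smooth [simp]: "X \<in> \<V> \<Longrightarrow> X f \<in> \<C>"
  by (cases "f \<in> \<C>") (simp_all add: vector_fieldsD(1) field_nonsmooth)

lemma vector_fieldsI:
  assumes "\<And>f. f \<in> \<C> \<Longrightarrow> X f \<in> \<C>" "\<And>f. f \<notin> \<C> \<Longrightarrow> X f = 0"
    "\<And>f g. f \<in> \<C> \<Longrightarrow> g \<in> \<C> \<Longrightarrow> X (f + g) = X f + X g"
    "\<And>f c. f \<in> \<C> \<Longrightarrow> X ((\<lambda>_. c) * f) = (\<lambda>_. c) * X f"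
    "\<And>f g. f \<in> \<C> \<Longrightarrow> g \<in> \<C> \<Longrightarrow> X (f * g) = X f * g + f * X g"
  shows "X \<in> \<V>"
  using assms unfolding vector_fields_def by blast

lemma field_const: assumes "X \<in> \<V>" shows "X (\<lambda>_. c) = 0"
proof -
  have "X 1 = X 1 + X 1"
    using field_mult[OF assms smooth_const[of 1] smooth_const[of 1]] unfolding one_fun_def[symmetric]
    by simp
  then have "X 1 = 0" by simp
  then show ?thesis
    using field_const_mult[OF assms smooth_const[of 1], of c] unfolding one_fun_def[symmetric]
    by simp
qed

lemma field_zero: "X \<in> \<V> \<Longrightarrow> X 0 = 0"
  using field_const[of X 0] unfolding zero_fun_def .

lemma field_uminus: assumes "X \<in> \<V>" shows "X (- f) = - X f"
proof (cases "f \<in> \<C>")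
  case True
  then have "X (- f) + X f = 0"
    using field_add[OF assms, of "- f" f] field_zero[OF assms] by (metis ab_left_minus smooth_uminus)
  then show ?thesis by (simp only: eq_neg_iff_add_eq_0)
next
  case False
  then have "- f \<notin> \<C>" using smooth_uminus[of "- f"] by (metis minus_minus)
  then show ?thesis using False field_nonsmooth[OF assms] by (metis neg_equal_0_iff_equal)
qed

lemma field_diff: "X \<in> \<V> \<Longrightarrow> f \<in> \<C> \<Longrightarrow> g \<in> \<C> \<Longrightarrow> X (f - g) = X f - X g"
  using field_add[of X f "- g"] field_uminus[of X g] by (metis diff_conv_add_uminus smooth_uminus)

lemmas field_rules = field_add field_diff field_mult field_uminus

lemma field_zero_in [simp]: "0 \<in> \<V>"
  by (rule vector_fieldsI) auto

lemma field_add_in [simp]: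
  assumes "X \<in> \<V>" "Y \<in> \<V>" shows "X + Y \<in> \<V>"
  using field_nonsmooth[OF assms(1)] field_nonsmooth[OF assms(2)]
  by (intro vector_fieldsI)
     (simp_all add: assms field_add[OF assms(1)] field_add[OF assms(2)] field_const[OF assms(1)]
       field_const[OF assms(2)] field_mult[OF assms(1)] field_mult[OF assms(2)] algebra_simps)

lemma field_vscale_in [simp]:
  assumes "f \<in> \<C>" "X \<in> \<V>" shows "vscale f X \<in> \<V>"
  using field_nonsmooth[OF assms(2)]
  by (intro vector_fieldsI)
     (simp_all add: assms vscale_apply field_add[OF assms(2)] field_const[OF assms(2)]
       field_mult[OF assms(2)] algebra_simps)

lemma field_uminus_in [simp]: assumes "X \<in> \<V>" shows "- X \<in> \<V>"
proof -
  have "vscale (- 1) X = - X" by simp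
  then show ?thesis
    using field_vscale_in[OF smooth_uminus[OF smooth_const[of 1]] assms]
    unfolding one_fun_def[symmetric] by metis
qed

lemma field_diff_in [simp]: "X \<in> \<V> \<Longrightarrow> Y \<in> \<V> \<Longrightarrow> X - Y \<in> \<V>"
  using field_add_in[of X "- Y"] by (metis diff_conv_add_uminus field_uminus_in)

lemma field_sum_in [simp]: "(\<And>i. i \<in> I \<Longrightarrow> X i \<in> \<V>) \<Longrightarrow> (\<Sum>i\<in>I. X i) \<in> \<V>"
  by (induction I rule: infinite_finite_induct) auto

lemma bracket_in [simp]: assumes "X \<in> \<V>" "Y \<in> \<V>" shows "bracket X Y \<in> \<V>"
  using field_nonsmooth[OF assms(1)] field_nonsmooth[OF assms(2)]
  by (intro vector_fieldsI)
     (simp_all add: assms bracket_def field_zero field_rules[OF assms(1)] field_rules[OF assms(2)]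
       field_const[OF assms(1)] field_const[OF assms(2)] algebra_simps)

lemma bracket_add_left:
  assumes "X \<in> \<V>" "Z \<in> \<V>" "Y \<in> \<V>"
  shows "bracket (X + Z) Y = bracket X Y + bracket Z Y"
  by (rule ext) (simp add: bracket_def field_rules[OF assms(3)] assms)

lemma bracket_vscale_left:
  assumes "X \<in> \<V>" "Y \<in> \<V>" "f \<in> \<C>"
  shows "bracket (vscale f X) Y = vscale f (bracket X Y) - vscale (Y f) X"
  by (rule ext) (simp add: assms bracket_def vscale_apply field_rules[OF assms(2)] algebra_simps)

lemma smooth_cnj_iff [simp]: "(\<lambda>x. cnj (f x)) \<in> \<C> \<longleftrightarrow> f \<in> \<C>"
  using smooth_cnj[of f] smooth_cnj[of "\<lambda>x. cnj (f x)"] by auto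

lemma conj_in [simp]: assumes X: "X \<in> \<V>" shows "conj_field X \<in> \<V>"
proof -
  have "X (\<lambda>y. cnj (f y + g y)) = X (\<lambda>y. cnj (f y)) + X (\<lambda>y. cnj (g y))"
    if "f \<in> \<C>" "g \<in> \<C>" for f g
    using field_add[OF X smooth_cnj[OF that(1)] smooth_cnj[OF that(2)]] by (simp add: plus_fun_def)
  moreover have "X (\<lambda>y. cnj (f y * g y)) =
      X (\<lambda>y. cnj (f y)) * (\<lambda>y. cnj (g y)) + (\<lambda>y. cnj (f y)) * X (\<lambda>y. cnj (g y))"
    if "f \<in> \<C>" "g \<in> \<C>" for f g
    using field_mult[OF X smooth_cnj[OF that(1)] smooth_cnj[OF that(2)]] by (simp add: times_fun_def)
  moreover have "X (\<lambda>y. cnj (c * f y)) = (\<lambda>_. cnj c) * X (\<lambda>y. cnj (f y))"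
    if "f \<in> \<C>" for c f
    using field_const_mult[OF X smooth_cnj[OF that]] by (simp add: times_fun_def)
  ultimately show ?thesis
    by (intro vector_fieldsI)
       (use X field_nonsmooth[OF X] in \<open>auto simp: conj_field_def fun_eq_iff\<close>)
qed

lemma conj_bracket:
  "X \<in> \<V> \<Longrightarrow> Y \<in> \<V> \<Longrightarrow> conj_field (bracket X Y) = bracket (conj_field X) (conj_field Y)"
  by (simp add: conj_field_def bracket_def fun_eq_iff)

abbreviation "\<R> \<equiv> real_fields A"

lemma real_field_iff: "X \<in> \<R> \<longleftrightarrow> X \<in> \<V> \<and> conj_field X = X"
  by (simp add: real_fields_def)

text \<open>Statements that are given for real fields, such as the reality of the metric or of a connection,
  are extended to complex ones through this decomposition.\<close>

lemma real_imaginary_parts: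
  assumes "X \<in> \<V>"
  obtains P Q where "P \<in> \<R>" "Q \<in> \<R>" "X = P + vscale (\<lambda>_. \<i>) Q"
    "conj_field X = P - vscale (\<lambda>_. \<i>) Q"
proof -
  let ?P = "vscale (\<lambda>_. 1/2) (X + conj_field X)"
  let ?Q = "vscale (\<lambda>_. -\<i>/2) (X - conj_field X)"
  show ?thesis
  proof
    show "?P \<in> \<R>"
      using assms by (simp add: real_field_iff conj_vscale conj_add add.commute)
    have "conj_field ?Q = vscale (\<lambda>_. \<i>/2) (conj_field X - X)"
      by (simp add: conj_vscale conj_diff)
    also have "\<dots> = ?Q"
      by (simp add: vscale_def fun_eq_iff field_simps)
    finally show "?Q \<in> \<R>"
      using assms by (simp add: real_field_iff)
    show "X = ?P + vscale (\<lambda>_. \<i>) ?Q" "conj_field X = ?P - vscale (\<lambda>_. \<i>) ?Q"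
      by (auto simp: vscale_def fun_eq_iff field_simps)
  qed
qed

end

context lie_group_manifold
begin

lemma pushforward_in [simp]:
  assumes X: "X \<in> \<V>" shows "pushforward G a X \<in> \<V>"
proof -
  have "X (\<lambda>y. f (a \<otimes>\<^bsub>G\<^esub> y) + g (a \<otimes>\<^bsub>G\<^esub> y)) =
      X (\<lambda>y. f (a \<otimes>\<^bsub>G\<^esub> y)) + X (\<lambda>y. g (a \<otimes>\<^bsub>G\<^esub> y))"
    if "f \<in> \<C>" "g \<in> \<C>" for f g
    using field_add[OF X smooth_translate[OF that(1)] smooth_translate[OF that(2)], of a a]
    by (simp add: plus_fun_def)
  moreover have "X (\<lambda>y. f (a \<otimes>\<^bsub>G\<^esub> y) * g (a \<otimes>\<^bsub>G\<^esub> y)) =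
      X (\<lambda>y. f (a \<otimes>\<^bsub>G\<^esub> y)) * (\<lambda>y. g (a \<otimes>\<^bsub>G\<^esub> y)) + (\<lambda>y. f (a \<otimes>\<^bsub>G\<^esub> y)) * X (\<lambda>y. g (a \<otimes>\<^bsub>G\<^esub> y))"
    if "f \<in> \<C>" "g \<in> \<C>" for f g
    using field_mult[OF X smooth_translate[OF that(1)] smooth_translate[OF that(2)], of a a]
    by (simp add: times_fun_def)
  moreover have "X (\<lambda>y. c * f (a \<otimes>\<^bsub>G\<^esub> y)) = (\<lambda>_. c) * X (\<lambda>y. f (a \<otimes>\<^bsub>G\<^esub> y))"
    if "f \<in> \<C>" for c f
    using field_const_mult[OF X smooth_translate[OF that]] by (simp add: times_fun_def)
  moreover have "pushforward G a X f \<in> \<C>" for f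
    using smooth_translate[OF field_smooth[OF X]] by (simp add: pushforward_def)
  moreover have "f \<notin> \<C> \<Longrightarrow> X (\<lambda>y. f (a \<otimes>\<^bsub>G\<^esub> y)) = 0" for f
    using field_nonsmooth[OF X] by (simp add: smooth_translate_iff)
  ultimately show ?thesis
    by (intro vector_fieldsI) (auto simp: pushforward_def fun_eq_iff)
qed

lemma pushforward_inverse: "pushforward G a (pushforward G (inv\<^bsub>G\<^esub> a) X) = X"
  by (simp add: pushforward_def)

lemma conj_pushforward: "conj_field (pushforward G a X) = pushforward G a (conj_field X)"
  by (simp add: pushforward_def conj_field_def)

abbreviation "\<LL> \<equiv> lie_algebra G A"

lemma left_invariant_iff: "X \<in> \<LL> \<longleftrightarrow> X \<in> \<R> \<and> (\<forall>a. pushforward G a X = X)"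
  by (simp add: lie_algebra_def)

lemma left_invariant_real [simp]: "X \<in> \<LL> \<Longrightarrow> X \<in> \<R>"
  by (simp add: left_invariant_iff)

lemma left_invariant_in [simp]: "X \<in> \<LL> \<Longrightarrow> X \<in> \<V>"
  by (simp add: left_invariant_iff real_field_iff)

lemma left_invariant_zero [simp]: "0 \<in> \<LL>"
  by (simp add: left_invariant_iff real_field_iff pushforward_def conj_field_def fun_eq_iff)

lemma left_invariant_add [simp]: "X \<in> \<LL> \<Longrightarrow> Y \<in> \<LL> \<Longrightarrow> X + Y \<in> \<LL>"
  by (simp add: left_invariant_iff real_field_iff pushforward_def conj_add)
     (simp add: fun_eq_iff)

lemma left_invariant_scale [simp]: "X \<in> \<LL> \<Longrightarrow> vscale (\<lambda>_. of_real c) X \<in> \<LL>"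
  by (simp add: left_invariant_iff real_field_iff pushforward_def conj_vscale)
     (simp add: fun_eq_iff vscale_def)

lemma left_invariant_sum [simp]: "(\<And>i. i \<in> I \<Longrightarrow> X i \<in> \<LL>) \<Longrightarrow> (\<Sum>i\<in>I. X i) \<in> \<LL>"
  by (induction I rule: infinite_finite_induct) auto

text \<open>Left translations act transitively.\<close>

lemma constant_function:
  assumes "\<And>a x. f (a \<otimes>\<^bsub>G\<^esub> x) = f x"
  shows "f = (\<lambda>_. f \<one>\<^bsub>G\<^esub>)"
  using assms[of _ "\<one>\<^bsub>G\<^esub>"] by (simp add: fun_eq_iff)

end

section \<open>Forms of low degree\<close>

lemma sum_fun_apply: "(\<Sum>i\<in>I. f i) x = (\<Sum>i\<in>I. f i x)"
  by (induction I rule: infinite_finite_induct) auto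

lemma wedge_1_1: "wedge 1 1 \<alpha> \<beta> [X, Y] = \<alpha> [X] * \<beta> [Y] - \<alpha> [Y] * \<beta> [X]"
proof
  fix x
  have s: "{..<1+1} = insert (1::nat) (insert 0 {})" by auto
  have f1: "finite {0::nat}" "1 \<notin> {0::nat}" by auto
  have f0: "finite ({}::nat set)" "0 \<notin> ({}::nat set)" by auto
  have r: "[0..<1] = [0]" "[1..<1+1] = [1]" by (simp_all add: upt_rec)
  show "wedge 1 1 \<alpha> \<beta> [X, Y] x = (\<alpha> [X] * \<beta> [Y] - \<alpha> [Y] * \<beta> [X]) x"
    unfolding wedge_def s r
    unfolding sum_over_permutations_insert[OF f1] sum_over_permutations_insert[OF f0] permutes_empty
    by (simp add: sign_swap_id sign_compose permutation_swap_id transpose_def)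
qed

text \<open>The 24 terms of the square of a 2-form fall into three groups of eight equal ones, one for
  each splitting of the four arguments into pairs.\<close>

lemma wedge_2_2_square:
  assumes skew: "\<And>X Y. X \<in> {a, b, c, d} \<Longrightarrow> Y \<in> {a, b, c, d} \<Longrightarrow> \<alpha> [Y, X] = - \<alpha> [X, Y]"
  shows "wedge 2 2 \<alpha> \<alpha> [a, b, c, d] = (\<lambda>_. 2) *
    (\<alpha> [a, b] * \<alpha> [c, d] - \<alpha> [a, c] * \<alpha> [b, d] + \<alpha> [a, d] * \<alpha> [b, c])"
proof
  fix x
  have s: "{..<2+2} = insert (3::nat) (insert 2 (insert 1 (insert 0 {})))" by auto
  have f3: "finite {2, 1, 0::nat}" "3 \<notin> {2, 1, 0::nat}" by auto
  have f2: "finite {1, 0::nat}" "2 \<notin> {1, 0::nat}" by auto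
  have f1: "finite {0::nat}" "1 \<notin> {0::nat}" by auto
  have f0: "finite ({}::nat set)" "0 \<notin> ({}::nat set)" by auto
  have r: "[0..<2] = [0, 1]" "[2..<2+2] = [2, 3]" by (simp_all add: upt_rec)
  have sk: "\<alpha> [b, a] x = - \<alpha> [a, b] x" "\<alpha> [c, a] x = - \<alpha> [a, c] x" "\<alpha> [d, a] x = - \<alpha> [a, d] x"
    "\<alpha> [c, b] x = - \<alpha> [b, c] x" "\<alpha> [d, b] x = - \<alpha> [b, d] x" "\<alpha> [d, c] x = - \<alpha> [c, d] x"
    using skew[of a b] skew[of a c] skew[of a d] skew[of b c] skew[of b d] skew[of c d] by auto
  show "wedge 2 2 \<alpha> \<alpha> [a, b, c, d] x = ((\<lambda>_. 2) *
    (\<alpha> [a, b] * \<alpha> [c, d] - \<alpha> [a, c] * \<alpha> [b, d] + \<alpha> [a, d] * \<alpha> [b, c])) x"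
    unfolding wedge_def s r
    unfolding sum_over_permutations_insert[OF f3] sum_over_permutations_insert[OF f2]
      sum_over_permutations_insert[OF f1] sum_over_permutations_insert[OF f0] permutes_empty
    by (simp add: sign_swap_id sign_compose permutation_swap_id permutation_compose transpose_def
        sk field_simps)
qed

lemma ext_deriv_1: "ext_deriv \<alpha> [X, Y] = X (\<alpha> [Y]) - Y (\<alpha> [X]) - \<alpha> [bracket X Y]"
  by (rule ext) (simp add: ext_deriv_def omit_def numeral_2_eq_2 lessThan_Suc)

lemma ext_deriv_2: "ext_deriv \<alpha> [X, Y, Z] =
    X (\<alpha> [Y, Z]) - Y (\<alpha> [X, Z]) + Z (\<alpha> [X, Y])
    - \<alpha> [bracket X Y, Z] + \<alpha> [bracket X Z, Y] - \<alpha> [bracket Y Z, X]"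
  by (rule ext) (simp add: ext_deriv_def omit_def eval_nat_numeral lessThan_Suc)

lemma ext_deriv_4: "ext_deriv \<alpha> [X, Y, Z, U, V] =
    X (\<alpha> [Y, Z, U, V]) - Y (\<alpha> [X, Z, U, V]) + Z (\<alpha> [X, Y, U, V]) - U (\<alpha> [X, Y, Z, V])
    + V (\<alpha> [X, Y, Z, U])
    - \<alpha> [bracket X Y, Z, U, V] + \<alpha> [bracket X Z, Y, U, V] - \<alpha> [bracket X U, Y, Z, V]
    + \<alpha> [bracket X V, Y, Z, U]
    - \<alpha> [bracket Y Z, X, U, V] + \<alpha> [bracket Y U, X, Z, V] - \<alpha> [bracket Y V, X, Z, U]
    - \<alpha> [bracket Z U, X, Y, V] + \<alpha> [bracket Z V, X, Y, U] - \<alpha> [bracket U V, X, Y, Z]"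
  by (rule ext) (simp add: ext_deriv_def omit_def eval_nat_numeral lessThan_Suc)

section \<open>The square of a closed 2-form\<close>

context manifold
begin

lemma field_lists_Cons [simp]: "X # Xs \<in> field_lists A (Suc k) \<longleftrightarrow> X \<in> \<V> \<and> Xs \<in> field_lists A k"
  by (auto simp: field_lists_def)

lemma field_lists_Nil [simp]: "[] \<in> field_lists A 0"
  by (auto simp: field_lists_def)

lemma field_lists_pair: "[X, Y] \<in> field_lists A 2 \<longleftrightarrow> X \<in> \<V> \<and> Y \<in> \<V>"
  by (auto simp: field_lists_def)

lemma field_lists_4E:
  assumes "Xs \<in> field_lists A 4"
  obtains a b c d where "Xs = [a, b, c, d]" "a \<in> \<V>" "b \<in> \<V>" "c \<in> \<V>" "d \<in> \<V>"
  using assms by (auto simp: field_lists_def numeral_eq_Suc length_Suc_conv)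

lemma field_lists_5E:
  assumes "Xs \<in> field_lists A 5"
  obtains a b c d e where "Xs = [a, b, c, d, e]" "a \<in> \<V>" "b \<in> \<V>" "c \<in> \<V>" "d \<in> \<V>" "e \<in> \<V>"
  using assms by (auto simp: field_lists_def numeral_eq_Suc length_Suc_conv)

lemma field_lists_mapI:
  "(\<And>i. i < k \<Longrightarrow> F i \<in> \<V>) \<Longrightarrow> map F [0..<k] \<in> field_lists A k"
  by (auto simp: field_lists_def)

lemma field_lists_permute:
  assumes "Xs \<in> field_lists A (p + q)" "\<pi> permutes {..<p + q}"
  shows "map (\<lambda>i. Xs ! \<pi> i) [0..<p] \<in> field_lists A p"
    and "map (\<lambda>i. Xs ! \<pi> i) [p..<p+q] \<in> field_lists A q"
proof -
  have "Xs ! \<pi> i \<in> \<V>" if "i < p + q" for i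
    using permutes_in_image[OF assms(2), of i] that assms(1) by (auto simp: field_lists_def)
  then show "map (\<lambda>i. Xs ! \<pi> i) [0..<p] \<in> field_lists A p"
    and "map (\<lambda>i. Xs ! \<pi> i) [p..<p+q] \<in> field_lists A q"
    by (auto simp: field_lists_def)
qed

lemma field_lists_omit:
  assumes "Xs \<in> field_lists A (Suc k)" "i < Suc k"
  shows "omit i Xs \<in> field_lists A k"
  using assms by (auto simp: field_lists_def omit_def dest: in_set_takeD in_set_dropD)

lemma ext_deriv_zero:
  assumes \<beta>: "\<And>Ys. Ys \<in> field_lists A k \<Longrightarrow> \<beta> Ys = 0" and Xs: "Xs \<in> field_lists A (Suc k)"
  shows "ext_deriv \<beta> Xs = 0"
proof
  fix x
  have len: "length Xs = Suc k" using Xs by (simp add: field_lists_def)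
  have in_V: "Xs ! i \<in> \<V>" if "i < Suc k" for i
    using Xs that by (auto simp: field_lists_def)
  have 1: "(Xs ! i) (\<beta> (omit i Xs)) x = 0" if "i < Suc k" for i
    using that by (simp add: \<beta> field_lists_omit[OF Xs] field_zero[OF in_V])
  have 2: "\<beta> (bracket (Xs ! i) (Xs ! j) # omit i (omit j Xs)) x = 0" if ij: "i < j" "j < Suc k" for i j
  proof -
    obtain m where m: "k = Suc m" using ij by (cases k) auto
    have "omit i (omit j Xs) \<in> field_lists A m"
      using field_lists_omit[of "omit j Xs" m i] field_lists_omit[OF Xs, of j] ij m by simp
    then show ?thesis using ij m by (simp add: \<beta> in_V)
  qed
  show "ext_deriv \<beta> Xs x = 0 x"
    unfolding ext_deriv_def len by (simp add: 1 2)
qed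

context
  fixes \<alpha> assumes \<alpha>: "diff_form A 2 \<alpha>"
begin

lemma two_form:
  assumes "X \<in> \<V>" "Y \<in> \<V>"
  shows two_form_smooth: "\<alpha> [X, Y] \<in> \<C>"
    and two_form_add_left: "Z \<in> \<V> \<Longrightarrow> \<alpha> [X + Z, Y] = \<alpha> [X, Y] + \<alpha> [Z, Y]"
    and two_form_add_right: "Z \<in> \<V> \<Longrightarrow> \<alpha> [X, Y + Z] = \<alpha> [X, Y] + \<alpha> [X, Z]"
    and two_form_scale_left: "f \<in> \<C> \<Longrightarrow> \<alpha> [vscale f X, Y] = f * \<alpha> [X, Y]"
    and two_form_scale_right: "f \<in> \<C> \<Longrightarrow> \<alpha> [X, vscale f Y] = f * \<alpha> [X, Y]"
proof -
  have XY: "[X, Y] \<in> field_lists A 2"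
    using assms by (simp add: field_lists_pair)
  note r = \<alpha>[unfolded diff_form_def, rule_format, OF XY]
  show "\<alpha> [X, Y] \<in> \<C>" using r by blast
  show "\<alpha> [X + Z, Y] = \<alpha> [X, Y] + \<alpha> [Z, Y]" "\<alpha> [X, Y + Z] = \<alpha> [X, Y] + \<alpha> [X, Z]" if "Z \<in> \<V>"
    using r[THEN conjunct2, THEN conjunct1, rule_format, of 0 Z]
      r[THEN conjunct2, THEN conjunct1, rule_format, of 1 Z] that by simp_all
  show "\<alpha> [vscale f X, Y] = f * \<alpha> [X, Y]" "\<alpha> [X, vscale f Y] = f * \<alpha> [X, Y]" if "f \<in> \<C>"
    using r[THEN conjunct2, THEN conjunct2, THEN conjunct1, rule_format, of 0 f]
      r[THEN conjunct2, THEN conjunct2, THEN conjunct1, rule_format, of 1 f] that by simp_all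
qed

lemma two_form_alternating: "X \<in> \<V> \<Longrightarrow> \<alpha> [X, X] = 0"
  using \<alpha>[unfolded diff_form_def, rule_format, of "[X, X]", THEN conjunct2, THEN conjunct2,
        THEN conjunct2, rule_format, of 0 1] by (simp add: field_lists_pair)

lemma two_form_skew:
  assumes X: "X \<in> \<V>" "Y \<in> \<V>"
  shows "\<alpha> [Y, X] = - \<alpha> [X, Y]"
proof -
  have "\<alpha> [Y, X] + \<alpha> [X, Y] = \<alpha> [X + Y, X + Y]"
    using X by (simp add: two_form_add_left two_form_add_right two_form_alternating[OF X(1)]
        two_form_alternating[OF X(2)] add.commute)
  also have "\<dots> = 0" using X by (simp add: two_form_alternating)
  finally show ?thesis by (simp only: eq_neg_iff_add_eq_0)
qed

end

text \<open>The Leibniz rule: each term of \<open>d(\<alpha> \<and> \<alpha>)\<close> contains a factor \<open>d\<alpha>(X,Y,Z)\<close> for three of the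
  five arguments.\<close>

lemma closed_square:
  assumes \<alpha>: "diff_form A 2 \<alpha>" and closed: "form_eq A 3 (ext_deriv \<alpha>) 0"
  shows "form_eq A 5 (ext_deriv (\<lambda>Xs. (\<lambda>_. c) * wedge 2 2 \<alpha> \<alpha> Xs)) 0"
  unfolding form_eq_def
proof
  fix Xs assume "Xs \<in> field_lists A 5"
  then obtain X Y Z U V where Xs: "Xs = [X, Y, Z, U, V]"
    and V: "X \<in> \<V>" "Y \<in> \<V>" "Z \<in> \<V>" "U \<in> \<V>" "V \<in> \<V>"
    by (rule field_lists_5E)
  define w where "w X Y = \<alpha> [X, Y]" for X Y
  let ?Q = "\<lambda>Xs. (\<lambda>_. c) * wedge 2 2 \<alpha> \<alpha> Xs"
  have sm: "w P Q \<in> \<C>" if "P \<in> \<V>" "Q \<in> \<V>" for P Q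
    unfolding w_def by (rule two_form_smooth[OF \<alpha> that])
  have Q: "?Q [P, Q, R, S] = (\<lambda>_. 2 * c) * (w P Q * w R S - w P R * w Q S + w P S * w Q R)"
    if "P \<in> \<V>" "Q \<in> \<V>" "R \<in> \<V>" "S \<in> \<V>" for P Q R S
  proof -
    have "wedge 2 2 \<alpha> \<alpha> [P, Q, R, S] = (\<lambda>_. 2) * (w P Q * w R S - w P R * w Q S + w P S * w Q R)"
      unfolding w_def by (rule wedge_2_2_square, rule two_form_skew[OF \<alpha>]) (use that in auto)
    then show ?thesis by (simp add: fun_eq_iff)
  qed
  have D: "W (?Q [P, Q, R, S]) =
      (\<lambda>_. 2 * c) * (W (w P Q) * w R S + w P Q * W (w R S) - W (w P R) * w Q S - w P R * W (w Q S)
        + W (w P S) * w Q R + w P S * W (w Q R))"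
    if "W \<in> \<V>" "P \<in> \<V>" "Q \<in> \<V>" "R \<in> \<V>" "S \<in> \<V>" for W P Q R S
    using that by (simp add: Q sm field_mult[OF that(1)] field_const[OF that(1)]
        field_add[OF that(1)] field_diff[OF that(1)] algebra_simps)
  have cl: "P (w Q R) = Q (w P R) - R (w P Q) + w (bracket P Q) R - w (bracket P R) Q + w (bracket Q R) P"
    if "P \<in> \<V>" "Q \<in> \<V>" "R \<in> \<V>" for P Q R
  proof -
    have "ext_deriv \<alpha> [P, Q, R] = 0"
      using closed that by (simp add: form_eq_def numeral_3_eq_3)
    then show ?thesis by (simp add: ext_deriv_2 w_def algebra_simps)
  qed
  show "ext_deriv ?Q Xs = 0 Xs"
  proof
    fix x
    \<comment> \<open>one instance for each choice of three among the five arguments\<close>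
    note c = cl[OF V(1,2,3)] cl[OF V(1,2,4)] cl[OF V(1,2,5)] cl[OF V(1,3,4)] cl[OF V(1,3,5)]
      cl[OF V(1,4,5)] cl[OF V(2,3,4)] cl[OF V(2,3,5)] cl[OF V(2,4,5)] cl[OF V(3,4,5)]
    show "ext_deriv ?Q Xs x = 0 Xs x"
      unfolding Xs ext_deriv_4
      unfolding D[OF V(1,2,3,4,5)] D[OF V(2,1,3,4,5)] D[OF V(3,1,2,4,5)] D[OF V(4,1,2,3,5)]
        D[OF V(5,1,2,3,4)]
      by (simp only: Q V bracket_in c) (simp add: algebra_simps)
  qed
qed

end

section \<open>Left-invariant forms\<close>

context lie_group_manifold
begin

lemma field_lists_pushforward:
  "Xs \<in> field_lists A k \<Longrightarrow> map (pushforward G a) Xs \<in> field_lists A k"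
  by (auto simp: field_lists_def)

lemma wedge_left_invariant:
  assumes \<alpha>: "left_invariant_form G A p \<alpha>" and \<beta>: "left_invariant_form G A q \<beta>"
  shows "left_invariant_form G A (p + q) (wedge p q \<alpha> \<beta>)"
  unfolding left_invariant_form_def
proof safe
  fix a x Xs assume Xs: "Xs \<in> field_lists A (p + q)"
  have "\<alpha> (map (\<lambda>i. map (pushforward G a) Xs ! \<pi> i) [0..<p]) (a \<otimes>\<^bsub>G\<^esub> x) =
          \<alpha> (map (\<lambda>i. Xs ! \<pi> i) [0..<p]) x"
    and "\<beta> (map (\<lambda>i. map (pushforward G a) Xs ! \<pi> i) [p..<p+q]) (a \<otimes>\<^bsub>G\<^esub> x) =
          \<beta> (map (\<lambda>i. Xs ! \<pi> i) [p..<p+q]) x"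
    if \<pi>: "\<pi> permutes {..<p+q}" for \<pi>
  proof -
    have "\<pi> i < length Xs" if "i < p + q" for i
      using permutes_in_image[OF \<pi>, of i] that Xs by (auto simp: field_lists_def)
    then have mm: "map (\<lambda>i. map (pushforward G a) Xs ! \<pi> i) I = map (pushforward G a) (map (\<lambda>i. Xs ! \<pi> i) I)"
      if "set I \<subseteq> {..<p+q}" for I
      using that by (auto intro!: nth_map)
    have m: "map (\<lambda>i. map (pushforward G a) Xs ! \<pi> i) [0..<p] = map (pushforward G a) (map (\<lambda>i. Xs ! \<pi> i) [0..<p])"
      "map (\<lambda>i. map (pushforward G a) Xs ! \<pi> i) [p..<p+q] = map (pushforward G a) (map (\<lambda>i. Xs ! \<pi> i) [p..<p+q])"
      by (rule mm; auto)+
    show "\<alpha> (map (\<lambda>i. map (pushforward G a) Xs ! \<pi> i) [0..<p]) (a \<otimes>\<^bsub>G\<^esub> x) =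
          \<alpha> (map (\<lambda>i. Xs ! \<pi> i) [0..<p]) x"
      unfolding m using \<alpha> field_lists_permute(1)[OF Xs \<pi>] unfolding left_invariant_form_def by blast
    show "\<beta> (map (\<lambda>i. map (pushforward G a) Xs ! \<pi> i) [p..<p+q]) (a \<otimes>\<^bsub>G\<^esub> x) =
          \<beta> (map (\<lambda>i. Xs ! \<pi> i) [p..<p+q]) x"
      unfolding m using \<beta> field_lists_permute(2)[OF Xs \<pi>] unfolding left_invariant_form_def by blast
  qed
  then show "wedge p q \<alpha> \<beta> (map (pushforward G a) Xs) (a \<otimes>\<^bsub>G\<^esub> x) = wedge p q \<alpha> \<beta> Xs x"
    unfolding wedge_def by (intro arg_cong2[where f="(/)"] sum.cong refl) simp
qed

lemma conj_form_left_invariant: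
  assumes "left_invariant_form G A k \<alpha>"
  shows "left_invariant_form G A k (conj_form \<alpha>)"
  unfolding left_invariant_form_def
proof safe
  fix a x Xs assume "Xs \<in> field_lists A k"
  then have "map conj_field Xs \<in> field_lists A k" by (auto simp: field_lists_def)
  then have "\<alpha> (map (pushforward G a) (map conj_field Xs)) (a \<otimes>\<^bsub>G\<^esub> x) = \<alpha> (map conj_field Xs) x"
    using assms unfolding left_invariant_form_def by blast
  then show "conj_form \<alpha> (map (pushforward G a) Xs) (a \<otimes>\<^bsub>G\<^esub> x) = conj_form \<alpha> Xs x"
    by (simp add: conj_form_def o_def conj_pushforward)
qed

text \<open>A left translation carries the condition that defines the norm at \<open>x\<close> to the one at \<open>a x\<close>. The
  two definite descriptions therefore denote the same number.\<close>

lemma form_norm_constant: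
  assumes "left_invariant_form G A 2 \<omega>" "left_invariant_form G A 3 \<Psi>"
  shows "form_norm A \<omega> \<Psi> (a \<otimes>\<^bsub>G\<^esub> x) = form_norm A \<omega> \<Psi> x"
proof -
  let ?l = "wedge 4 2 (wedge 2 2 \<omega> \<omega>) \<omega>" and ?r = "wedge 3 3 \<Psi> (conj_form \<Psi>)"
  have l: "left_invariant_form G A 6 ?l" and r: "left_invariant_form G A 6 ?r"
    using wedge_left_invariant[OF wedge_left_invariant[OF assms(1,1), simplified] assms(1)]
      wedge_left_invariant[OF assms(2) conj_form_left_invariant[OF assms(2)]] by simp_all
  define P where "P s Xs x \<longleftrightarrow> of_real (s\<^sup>2) * (?l Xs x / fact 3) = \<i> * ?r Xs x" for s :: real and Xs x
  have inv: "P s (map (pushforward G a) Xs) (a \<otimes>\<^bsub>G\<^esub> x) \<longleftrightarrow> P s Xs x" if "Xs \<in> field_lists A 6" for s Xs a x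
    using l r that unfolding P_def left_invariant_form_def by simp
  have "(\<forall>Xs\<in>field_lists A 6. P s Xs (a \<otimes>\<^bsub>G\<^esub> x)) \<longleftrightarrow> (\<forall>Xs\<in>field_lists A 6. P s Xs x)" for s
  proof safe
    fix Xs assume "\<forall>Xs\<in>field_lists A 6. P s Xs (a \<otimes>\<^bsub>G\<^esub> x)" "Xs \<in> field_lists A 6"
    then show "P s Xs x" using inv field_lists_pushforward by blast
  next
    fix Xs assume *: "\<forall>Xs\<in>field_lists A 6. P s Xs x" "Xs \<in> field_lists A 6"
    then have "P s (map (pushforward G (inv\<^bsub>G\<^esub> a)) Xs) x" using field_lists_pushforward by blast
    then have "P s (map (pushforward G a) (map (pushforward G (inv\<^bsub>G\<^esub> a)) Xs)) (a \<otimes>\<^bsub>G\<^esub> x)"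
      using inv * field_lists_pushforward by blast
    then show "P s Xs (a \<otimes>\<^bsub>G\<^esub> x)" by (simp add: o_def pushforward_inverse)
  qed
  then show ?thesis
    unfolding form_norm_def P_def[symmetric] by simp
qed

end

section \<open>Complex and Hermitian structures\<close>

lemma vscale_const_uminus: "vscale (\<lambda>_. - c) X = - vscale (\<lambda>_. c) X"
  by (simp add: vscale_def fun_eq_iff)

locale complex_manifold = manifold A for A :: "('g::topological_space, 'n::finite) atlas" +
  fixes J :: "'g vf \<Rightarrow> 'g vf"
  assumes complex_structure: "complex_structure A J"
begin

lemma J_in [simp]: "X \<in> \<V> \<Longrightarrow> J X \<in> \<V>"
  and J_J [simp]: "X \<in> \<V> \<Longrightarrow> J (J X) = - X"
  and J_add: "X \<in> \<V> \<Longrightarrow> Y \<in> \<V> \<Longrightarrow> J (X + Y) = J X + J Y"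
  and J_vscale: "f \<in> \<C> \<Longrightarrow> X \<in> \<V> \<Longrightarrow> J (vscale f X) = vscale f (J X)"
  and J_real: "X \<in> \<R> \<Longrightarrow> J X \<in> \<R>"
  and J_integrable: "X \<in> \<V> \<Longrightarrow> Y \<in> \<V> \<Longrightarrow>
        bracket X Y + J (bracket (J X) Y) + J (bracket X (J Y)) - bracket (J X) (J Y) = 0"
  using complex_structure unfolding complex_structure_def by blast+

lemma J_uminus: "X \<in> \<V> \<Longrightarrow> J (- X) = - J X"
  using J_vscale[OF smooth_const, of X "-1"] by (simp add: vscale_const_uminus)

lemma J_diff: "X \<in> \<V> \<Longrightarrow> Y \<in> \<V> \<Longrightarrow> J (X - Y) = J X - J Y"
  using J_add[of X "- Y"] by (simp add: J_uminus)

lemma J_conj: assumes "X \<in> \<V>" shows "conj_field (J X) = J (conj_field X)"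
proof -
  obtain P Q where "P \<in> \<R>" "Q \<in> \<R>" "X = P + vscale (\<lambda>_. \<i>) Q" "conj_field X = P - vscale (\<lambda>_. \<i>) Q"
    using real_imaginary_parts[OF assms] .
  moreover from this have "P \<in> \<V>" "Q \<in> \<V>" "conj_field (J P) = J P" "conj_field (J Q) = J Q"
    using J_real by (auto simp: real_field_iff)
  ultimately show ?thesis
    by (simp add: J_add J_diff J_vscale conj_add conj_vscale vscale_const_uminus)
qed

lemma proj_10_in [simp]: "X \<in> \<V> \<Longrightarrow> proj_10 J X \<in> \<V>"
  and proj_01_in [simp]: "X \<in> \<V> \<Longrightarrow> proj_01 J X \<in> \<V>"
  by (simp_all add: proj_10_def proj_01_def)

lemma J_proj_10: "X \<in> \<V> \<Longrightarrow> J (proj_10 J X) = vscale (\<lambda>_. \<i>) (proj_10 J X)"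
  and J_proj_01: "X \<in> \<V> \<Longrightarrow> J (proj_01 J X) = vscale (\<lambda>_. -\<i>) (proj_01 J X)"
  by (simp_all add: proj_10_def proj_01_def J_vscale J_add J_diff)
     (simp_all add: vscale_def fun_eq_iff algebra_simps)

lemma proj_sum: "proj_10 J X + proj_01 J X = X"
  by (simp add: proj_10_def proj_01_def vscale_def fun_eq_iff field_simps)

lemma conj_proj_10: "X \<in> \<V> \<Longrightarrow> conj_field (proj_10 J X) = proj_01 J (conj_field X)"
  by (simp add: proj_10_def proj_01_def conj_vscale conj_diff J_conj vscale_const_uminus)

lemma conj_fields_01: "Z \<in> fields_10 A J \<Longrightarrow> conj_field Z \<in> fields_01 A J"
  and conj_fields_10: "Z \<in> fields_01 A J \<Longrightarrow> conj_field Z \<in> fields_10 A J"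
  by (auto simp: fields_10_def fields_01_def J_conj[symmetric] conj_vscale)

lemma proj_fields: "X \<in> \<V> \<Longrightarrow> proj_10 J X \<in> fields_10 A J"
  "X \<in> \<V> \<Longrightarrow> proj_01 J X \<in> fields_01 A J"
  by (simp_all add: fields_10_def fields_01_def J_proj_10 J_proj_01)

lemma type_part_zero:
  assumes "\<And>Ys. Ys \<in> field_lists A (p + q) \<Longrightarrow> \<alpha> Ys = 0" "Xs \<in> field_lists A (p + q)"
  shows "type_part J p q \<alpha> Xs = 0"
  unfolding type_part_def
proof (intro sum.neutral ballI assms(1) field_lists_mapI)
  fix S i assume "i < p + q"
  then have "Xs ! i \<in> \<V>" using assms(2) by (auto simp: field_lists_def)
  then show "(if i \<in> S then proj_10 J (Xs ! i) else proj_01 J (Xs ! i)) \<in> \<V>" by simp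
qed

end

locale hermitian_manifold = complex_manifold A J
  for A :: "('g::topological_space, 'n::finite) atlas" and J +
  fixes \<omega> :: "'g form"
  assumes hermitian: "hermitian_structure A J \<omega>"
begin

lemma omega_form: "diff_form A 2 \<omega>"
  using hermitian by (simp add: hermitian_structure_def pq_form_def numeral_2_eq_2)

abbreviation metric_of :: "'g vf \<Rightarrow> 'g vf \<Rightarrow> 'g \<Rightarrow> complex" (\<open>\<g>\<close>) where
  "\<g> \<equiv> metric J \<omega>"

lemma metric_omega: "\<g> X Y = \<omega> [X, J Y]"
  by (simp add: metric_def)

text \<open>The form is of type (1,1), and \<open>J\<close> multiplies the two parts of different type by \<open>i\<close> and by \<open>-i\<close>.\<close>

lemma omega_J_J: assumes "X \<in> \<V>" "Y \<in> \<V>" shows "\<omega> [J X, J Y] = \<omega> [X, Y]"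
proof -
  have S: "{S. S \<subseteq> {..<1+1} \<and> card S = 1} = {{0}, {1::nat}}"
    by (auto simp: card_1_singleton_iff)
  have t: "type_part J 1 1 \<omega> [X, Y] = \<omega> [proj_10 J X, proj_01 J Y] + \<omega> [proj_01 J X, proj_10 J Y]"
    for X Y unfolding type_part_def S by (simp add: upt_rec)
  have "form_eq A 2 (type_part J 1 1 \<omega>) \<omega>"
    using hermitian by (simp add: hermitian_structure_def pq_form_def numeral_2_eq_2)
  then have w: "\<omega> [X, Y] = \<omega> [proj_10 J X, proj_01 J Y] + \<omega> [proj_01 J X, proj_10 J Y]"
    if "X \<in> \<V>" "Y \<in> \<V>" for X Y
    using that unfolding form_eq_def t[symmetric] by (metis field_lists_pair)
  have p: "proj_10 J (J X) = vscale (\<lambda>_. \<i>) (proj_10 J X)"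
    "proj_01 J (J X) = vscale (\<lambda>_. -\<i>) (proj_01 J X)" if "X \<in> \<V>" for X
    unfolding proj_10_def proj_01_def using that
    by (simp_all add: vscale_def fun_eq_iff algebra_simps)
  show ?thesis
    using assms
    by (simp add: w[of "J X"] w[of X] p two_form_scale_left[OF omega_form] two_form_scale_right[OF omega_form])
       (simp add: fun_eq_iff)
qed

lemma metric_smooth [simp]: "X \<in> \<V> \<Longrightarrow> Y \<in> \<V> \<Longrightarrow> \<g> X Y \<in> \<C>"
  and metric_add_left: "X \<in> \<V> \<Longrightarrow> Y \<in> \<V> \<Longrightarrow> Z \<in> \<V> \<Longrightarrow> \<g> (X + Y) Z = \<g> X Z + \<g> Y Z"
  and metric_add_right: "X \<in> \<V> \<Longrightarrow> Y \<in> \<V> \<Longrightarrow> Z \<in> \<V> \<Longrightarrow> \<g> Z (X + Y) = \<g> Z X + \<g> Z Y"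
  and metric_scale_left: "f \<in> \<C> \<Longrightarrow> X \<in> \<V> \<Longrightarrow> Y \<in> \<V> \<Longrightarrow> \<g> (vscale f X) Y = f * \<g> X Y"
  and metric_scale_right: "f \<in> \<C> \<Longrightarrow> X \<in> \<V> \<Longrightarrow> Y \<in> \<V> \<Longrightarrow> \<g> X (vscale f Y) = f * \<g> X Y"
  by (simp_all add: metric_omega J_add J_vscale two_form[OF omega_form])

lemma metric_uminus_left: "X \<in> \<V> \<Longrightarrow> Y \<in> \<V> \<Longrightarrow> \<g> (- X) Y = - \<g> X Y"
  and metric_uminus_right: "X \<in> \<V> \<Longrightarrow> Y \<in> \<V> \<Longrightarrow> \<g> X (- Y) = - \<g> X Y"
  using metric_scale_left[OF smooth_const, of X Y "-1"] metric_scale_right[OF smooth_const, of X Y "-1"]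
  by (simp_all add: vscale_const_uminus) (simp_all add: fun_eq_iff)

lemma metric_zero_left [simp]: "Y \<in> \<V> \<Longrightarrow> \<g> 0 Y = 0"
  and metric_zero_right [simp]: "Y \<in> \<V> \<Longrightarrow> \<g> Y 0 = 0"
  using metric_scale_left[OF smooth_zero, of 0 Y] metric_scale_right[OF smooth_zero, of Y 0]
  by simp_all

lemma metric_diff_left: "X \<in> \<V> \<Longrightarrow> Y \<in> \<V> \<Longrightarrow> Z \<in> \<V> \<Longrightarrow> \<g> (X - Y) Z = \<g> X Z - \<g> Y Z"
  and metric_diff_right: "X \<in> \<V> \<Longrightarrow> Y \<in> \<V> \<Longrightarrow> Z \<in> \<V> \<Longrightarrow> \<g> Z (X - Y) = \<g> Z X - \<g> Z Y"
  using metric_add_left[of X "- Y" Z] metric_add_right[of X "- Y" Z]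
  by (simp_all add: metric_uminus_left metric_uminus_right)

lemmas metric_linear = metric_add_left metric_add_right metric_diff_left metric_diff_right
  metric_uminus_left metric_uminus_right metric_scale_left metric_scale_right

lemma metric_sum_left:
  "(\<And>i. i \<in> I \<Longrightarrow> X i \<in> \<V>) \<Longrightarrow> Y \<in> \<V> \<Longrightarrow> \<g> (\<Sum>i\<in>I. X i) Y = (\<Sum>i\<in>I. \<g> (X i) Y)"
  by (induction I rule: infinite_finite_induct) (auto simp: metric_add_left)

lemma omega_metric: "X \<in> \<V> \<Longrightarrow> Y \<in> \<V> \<Longrightarrow> \<omega> [X, Y] = - \<g> X (J Y)"
  using metric_uminus_right[of X Y] two_form_scale_right[OF omega_form, of X Y "\<lambda>_. - 1"]
  by (simp add: metric_omega vscale_const_uminus fun_eq_iff)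

lemma metric_sym: assumes "X \<in> \<V>" "Y \<in> \<V>" shows "\<g> Y X = \<g> X Y"
proof -
  have "\<g> X Y = \<omega> [J X, J (J Y)]" using omega_J_J[of X "J Y"] assms by (simp only: metric_omega J_in)
  also have "\<dots> = - \<omega> [J X, Y]"
    using assms two_form_scale_right[OF omega_form, of "J X" Y "\<lambda>_. - 1"]
    by (simp add: vscale_const_uminus fun_eq_iff)
  also have "\<dots> = \<g> Y X"
    using two_form_skew[OF omega_form, of "J X" Y] assms by (simp add: metric_omega)
  finally show ?thesis ..
qed

lemma metric_J_left: assumes "X \<in> \<V>" "Y \<in> \<V>" shows "\<g> (J X) Y = - \<g> X (J Y)"
proof -
  have "\<g> (J X) Y = \<omega> [X, Y]" using assms by (simp add: metric_omega omega_J_J)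
  then show ?thesis using assms by (simp add: omega_metric)
qed

lemma metric_J_J: "X \<in> \<V> \<Longrightarrow> Y \<in> \<V> \<Longrightarrow> \<g> (J X) (J Y) = \<g> X Y"
  by (simp add: metric_J_left metric_uminus_right)

lemma metric_J_orthogonal: assumes "X \<in> \<V>" shows "\<g> X (J X) = 0"
proof
  fix x
  have "\<g> X (J X) = - \<g> X (J X)"
    using metric_J_left[OF assms assms] metric_sym[of X "J X"] assms by simp
  then have "\<g> X (J X) x = - \<g> X (J X) x" by (metis uminus_apply)
  then show "\<g> X (J X) x = 0 x" by (simp add: eq_neg_iff_add_eq_0 flip: mult_2)
qed

lemma metric_real: "P \<in> \<R> \<Longrightarrow> Q \<in> \<R> \<Longrightarrow> \<g> P Q x \<in> \<real>"
  using hermitian J_real[of Q]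
  by (auto simp: hermitian_structure_def real_form_def metric_omega field_lists_pair real_field_iff)

lemma metric_conj:
  assumes "X \<in> \<V>" "Y \<in> \<V>"
  shows "\<g> (conj_field X) (conj_field Y) = (\<lambda>x. cnj (\<g> X Y x))"
proof
  fix x
  obtain P Q where P: "P \<in> \<R>" "Q \<in> \<R>" "X = P + vscale (\<lambda>_. \<i>) Q" "conj_field X = P - vscale (\<lambda>_. \<i>) Q"
    using real_imaginary_parts[OF assms(1)] .
  obtain P' Q' where P': "P' \<in> \<R>" "Q' \<in> \<R>" "Y = P' + vscale (\<lambda>_. \<i>) Q'" "conj_field Y = P' - vscale (\<lambda>_. \<i>) Q'"
    using real_imaginary_parts[OF assms(2)] .
  have V: "P \<in> \<V>" "Q \<in> \<V>" "P' \<in> \<V>" "Q' \<in> \<V>" using P P' by (auto simp: real_field_iff)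
  have r: "cnj (\<g> R S x) = \<g> R S x" if "R \<in> {P, Q}" "S \<in> {P', Q'}" for R S
    using metric_real[of R S x] P P' that by (auto simp: Reals_cnj_iff)
  show "\<g> (conj_field X) (conj_field Y) x = cnj (\<g> X Y x)"
    unfolding P(4) P'(4) unfolding P(3) P'(3) using V by (simp add: metric_linear r algebra_simps)
qed

text \<open>Definiteness on real fields only needs to be applied to the real and the imaginary part of a
  field, since both are orthogonal to everything if the field is.\<close>

lemma metric_nondegenerate:
  assumes U: "U \<in> \<V>" and orth: "\<And>Z. Z \<in> \<V> \<Longrightarrow> \<g> U Z = 0"
  shows "U = 0"
proof -
  have real: "P = 0" if P: "P \<in> \<R>" "\<g> P P = 0" for P
  proof (rule ccontr)
    assume "P \<noteq> 0"
    then obtain f x where "P f x \<noteq> 0" by (auto simp: fun_eq_iff)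
    then have "Re (\<g> P P x) > 0"
      using hermitian P(1) by (auto simp: hermitian_structure_def)
    then show False using P(2) by simp
  qed
  obtain P Q where PQ: "P \<in> \<R>" "Q \<in> \<R>" "U = P + vscale (\<lambda>_. \<i>) Q" "conj_field U = P - vscale (\<lambda>_. \<i>) Q"
    using real_imaginary_parts[OF U] .
  then have V: "P \<in> \<V>" "Q \<in> \<V>" by (auto simp: real_field_iff)
  have c: "\<g> (conj_field U) Z = 0" if "Z \<in> \<V>" for Z
    using metric_conj[OF U conj_in[OF that]] orth[OF conj_in[OF that]] by (simp add: fun_eq_iff)
  have "\<g> P Z x = 0 \<and> \<g> Q Z x = 0" if "Z \<in> \<V>" for Z x
    using fun_cong[OF c[OF that, unfolded PQ(4)], of x] fun_cong[OF orth[OF that, unfolded PQ(3)], of x] V that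
    by (simp add: metric_linear add_eq_0_iff)
  then have "\<g> P P = 0" "\<g> Q Q = 0" using V by (auto simp: fun_eq_iff)
  then have "P = 0" "Q = 0" using real PQ by blast+
  then show ?thesis using PQ by simp
qed

lemma metric_eqI:
  "X \<in> \<V> \<Longrightarrow> Y \<in> \<V> \<Longrightarrow> (\<And>Z. Z \<in> \<V> \<Longrightarrow> \<g> X Z = \<g> Y Z) \<Longrightarrow> X = Y"
  using metric_nondegenerate[of "X - Y"] by (simp add: metric_linear)

end

section \<open>Hermitian connections on Kaehler manifolds\<close>

locale metric_connection = hermitian_manifold A J \<omega>
  for A :: "('g::topological_space, 'n::finite) atlas" and J \<omega> +
  fixes D :: "'g connection"
  assumes connection: "hermitian_connection A J \<omega> D"
begin

lemma D_in [simp]: "X \<in> \<V> \<Longrightarrow> Y \<in> \<V> \<Longrightarrow> D X Y \<in> \<V>"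
  and D_add_left: "X \<in> \<V> \<Longrightarrow> Z \<in> \<V> \<Longrightarrow> Y \<in> \<V> \<Longrightarrow> D (X + Z) Y = D X Y + D Z Y"
  and D_add_right: "X \<in> \<V> \<Longrightarrow> Y \<in> \<V> \<Longrightarrow> Z \<in> \<V> \<Longrightarrow> D X (Y + Z) = D X Y + D X Z"
  and D_scale_left: "f \<in> \<C> \<Longrightarrow> X \<in> \<V> \<Longrightarrow> Y \<in> \<V> \<Longrightarrow> D (vscale f X) Y = vscale f (D X Y)"
  and D_scale_right: "f \<in> \<C> \<Longrightarrow> X \<in> \<V> \<Longrightarrow> Y \<in> \<V> \<Longrightarrow>
        D X (vscale f Y) = vscale (X f) Y + vscale f (D X Y)"
  and D_real: "X \<in> \<R> \<Longrightarrow> Y \<in> \<R> \<Longrightarrow> D X Y \<in> \<R>"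
  and D_J: "X \<in> \<V> \<Longrightarrow> Y \<in> \<V> \<Longrightarrow> D X (J Y) = J (D X Y)"
  and D_metric: "X \<in> \<V> \<Longrightarrow> Y \<in> \<V> \<Longrightarrow> Z \<in> \<V> \<Longrightarrow> X (\<g> Y Z) = \<g> (D X Y) Z + \<g> Y (D X Z)"
  using connection unfolding hermitian_connection_def affine_connection_def by blast+

lemma D_const_right: "X \<in> \<V> \<Longrightarrow> Y \<in> \<V> \<Longrightarrow> D X (vscale (\<lambda>_. c) Y) = vscale (\<lambda>_. c) (D X Y)"
  using D_scale_right[OF smooth_const, of X Y c] field_const[of X c] by simp

lemma D_zero_left [simp]: "Y \<in> \<V> \<Longrightarrow> D 0 Y = 0"
  and D_zero_right [simp]: "Y \<in> \<V> \<Longrightarrow> D Y 0 = 0"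
  using D_add_left[of 0 0 Y] D_add_right[of Y 0 0] by simp_all

lemma D_uminus_left: "X \<in> \<V> \<Longrightarrow> Y \<in> \<V> \<Longrightarrow> D (- X) Y = - D X Y"
  and D_uminus_right: "X \<in> \<V> \<Longrightarrow> Y \<in> \<V> \<Longrightarrow> D X (- Y) = - D X Y"
  using D_scale_left[OF smooth_const, of X Y "-1"] D_const_right[of X Y "-1"]
  by (simp_all add: vscale_const_uminus)

lemma D_diff_left: "X \<in> \<V> \<Longrightarrow> Z \<in> \<V> \<Longrightarrow> Y \<in> \<V> \<Longrightarrow> D (X - Z) Y = D X Y - D Z Y"
  and D_diff_right: "X \<in> \<V> \<Longrightarrow> Y \<in> \<V> \<Longrightarrow> Z \<in> \<V> \<Longrightarrow> D X (Y - Z) = D X Y - D X Z"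
  using D_add_left[of X "- Z" Y] D_add_right[of X Y "- Z"]
  by (simp_all add: D_uminus_left D_uminus_right)

lemma D_conj:
  assumes "X \<in> \<V>" "Y \<in> \<V>"
  shows "conj_field (D X Y) = D (conj_field X) (conj_field Y)"
proof -
  obtain P Q where P: "P \<in> \<R>" "Q \<in> \<R>" "X = P + vscale (\<lambda>_. \<i>) Q" "conj_field X = P - vscale (\<lambda>_. \<i>) Q"
    using real_imaginary_parts[OF assms(1)] .
  obtain P' Q' where P': "P' \<in> \<R>" "Q' \<in> \<R>" "Y = P' + vscale (\<lambda>_. \<i>) Q'" "conj_field Y = P' - vscale (\<lambda>_. \<i>) Q'"
    using real_imaginary_parts[OF assms(2)] .
  have V: "P \<in> \<V>" "Q \<in> \<V>" "P' \<in> \<V>" "Q' \<in> \<V>" using P P' by (auto simp: real_field_iff)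
  have r: "conj_field (D R S) = D R S" if "R \<in> {P, Q}" "S \<in> {P', Q'}" for R S
    using D_real[of R S] P P' that by (auto simp: real_field_iff)
  show ?thesis
    unfolding P(4) P'(4) unfolding P(3) P'(3) using V
    by (simp add: D_add_left D_add_right D_diff_left D_diff_right D_scale_left D_const_right
        conj_add conj_diff conj_vscale r vscale_const_uminus vscale_const_mult algebra_simps del: vf.scale_scale)
qed

abbreviation "T \<equiv> torsion D"

lemma torsion_in [simp]: "X \<in> \<V> \<Longrightarrow> Y \<in> \<V> \<Longrightarrow> T X Y \<in> \<V>"
  by (simp add: torsion_def)

lemma torsion_swap: "T Y X = - T X Y"
  by (simp add: torsion_def bracket_swap[of Y X])

lemma torsion_add_left: "X \<in> \<V> \<Longrightarrow> Y \<in> \<V> \<Longrightarrow> Z \<in> \<V> \<Longrightarrow> T (X + Y) Z = T X Z + T Y Z"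
  by (simp add: torsion_def D_add_left D_add_right bracket_add_left)

lemma torsion_scale_left:
  "f \<in> \<C> \<Longrightarrow> X \<in> \<V> \<Longrightarrow> Y \<in> \<V> \<Longrightarrow> T (vscale f X) Y = vscale f (T X Y)"
  by (simp add: torsion_def D_scale_left D_scale_right bracket_vscale_left algebra_simps)

lemma torsion_add_right: "X \<in> \<V> \<Longrightarrow> Y \<in> \<V> \<Longrightarrow> Z \<in> \<V> \<Longrightarrow> T Z (X + Y) = T Z X + T Z Y"
  using torsion_add_left[of X Y Z] by (simp add: torsion_swap[of Z])

lemma torsion_scale_right:
  "f \<in> \<C> \<Longrightarrow> X \<in> \<V> \<Longrightarrow> Y \<in> \<V> \<Longrightarrow> T Y (vscale f X) = vscale f (T Y X)"
  using torsion_scale_left[of f X Y] by (simp add: torsion_swap[of Y])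

text \<open>Rewriting brackets by covariant derivatives, the derivatives cancel in the Nijenhuis tensor
  of a parallel \<open>J\<close>, and only torsion is left.\<close>

lemma torsion_integrable:
  assumes "X \<in> \<V>" "Y \<in> \<V>"
  shows "T (J X) (J Y) = T X Y + J (T (J X) Y) + J (T X (J Y))"
proof -
  have b: "bracket X Y = D X Y - D Y X - T X Y" for X Y by (simp add: torsion_def)
  show ?thesis
    using J_integrable[OF assms] assms unfolding b
    by (simp add: J_add J_diff J_uminus D_J D_uminus_right algebra_simps)
qed

end

locale kaehler_manifold = hermitian_manifold A J \<omega>
  for A :: "('g::topological_space, 'n::finite) atlas" and J \<omega> +
  assumes closed: "form_eq A 3 (ext_deriv \<omega>) 0"
begin

lemma del_delbar_omega: "form_eq A 4 (\<lambda>Xs x. \<i> * del J 1 2 (delbar J 1 1 \<omega>) Xs x) 0"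
proof -
  have deg: "(1::nat) + (1 + 1) = 3" "(1::nat) + 1 + 2 = 4" by simp_all
  have "ext_deriv \<omega> Ys = 0" if "Ys \<in> field_lists A 3" for Ys
    using that closed by (simp add: form_eq_def)
  then have "delbar J 1 1 \<omega> Ys = 0" if "Ys \<in> field_lists A 3" for Ys
    unfolding delbar_def using that by (intro type_part_zero[of 1 "1 + 1", unfolded deg])
  then have "ext_deriv (delbar J 1 1 \<omega>) Ys = 0" if "Ys \<in> field_lists A 4" for Ys
    using ext_deriv_zero[of 3 "delbar J 1 1 \<omega>" Ys] that by simp
  then have "del J 1 2 (delbar J 1 1 \<omega>) Ys = 0" if "Ys \<in> field_lists A 4" for Ys
    unfolding del_def using that by (intro type_part_zero[of "1 + 1" 2, unfolded deg])
  then show ?thesis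
    by (simp add: form_eq_def fun_eq_iff)
qed

end

locale kaehler_connection = kaehler_manifold A J \<omega> + metric_connection A J \<omega> D
  for A :: "('g::topological_space, 'n::finite) atlas" and J \<omega> D
begin

text \<open>The left-hand side is \<open>d\<omega>(X,Y,Z)\<close> up to sign: as \<open>\<omega>\<close> is parallel, all covariant derivatives cancel.\<close>

lemma torsion_cyclic:
  assumes "X \<in> \<V>" "Y \<in> \<V>" "Z \<in> \<V>"
  shows "\<g> (T X Y) (J Z) + \<g> (T Y Z) (J X) + \<g> (T Z X) (J Y) = 0"
proof -
  have o: "P (\<omega> [Q, R]) = - \<g> (D P Q) (J R) - \<g> Q (J (D P R))"
    if "P \<in> \<V>" "Q \<in> \<V>" "R \<in> \<V>" for P Q R
    using that by (simp add: omega_metric field_uminus[OF that(1)] D_metric[OF that(1)] D_J)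
  have b: "bracket X Y = D X Y - D Y X - T X Y" for X Y by (simp add: torsion_def)
  have s: "\<g> Q (J (D P R)) = - \<g> (D P R) (J Q)" if "P \<in> \<V>" "Q \<in> \<V>" "R \<in> \<V>" for P Q R
    using that metric_sym[of Q "J (D P R)"] metric_J_left[of "D P R" Q] by simp
  have "ext_deriv \<omega> [X, Y, Z] = 0"
    using closed assms by (simp add: form_eq_def numeral_3_eq_3)
  then have "X (\<omega> [Y, Z]) - Y (\<omega> [X, Z]) + Z (\<omega> [X, Y])
    - \<omega> [bracket X Y, Z] + \<omega> [bracket X Z, Y] - \<omega> [bracket Y Z, X] = 0"
    by (simp only: ext_deriv_2)
  then show ?thesis
    unfolding o[OF assms] o[OF assms(2,1,3)] o[OF assms(3,1,2)]
    using assms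
    by (simp add: omega_metric s b metric_linear torsion_swap[of Z X] algebra_simps)
qed

end

text \<open>The torsion of the Bismut connection is a 3-form, so integrability and the cyclic identity
  become two linear relations between its values on arguments rotated by \<open>J\<close>, whose only common
  solution is zero.\<close>

theorem (in kaehler_connection) bismut_torsion_free:
  assumes bismut: "bismut_connection A J \<omega> D" and "X \<in> \<V>" "Y \<in> \<V>"
  shows "T X Y = 0"
proof (rule metric_nondegenerate)
  define t where "t X Y Z = \<g> (T X Y) Z" for X Y Z
  have alt: "t X Y Y = 0" if "X \<in> \<V>" "Y \<in> \<V>" for X Y
  proof -
    have "diff_form A 3 (\<lambda>Xs. t (Xs ! 0) (Xs ! 1) (Xs ! 2))"
      using bismut by (simp add: bismut_connection_def t_def)
    moreover have "[X, Y, Y] \<in> field_lists A 3" using that by (simp add: numeral_3_eq_3)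
    ultimately have "\<forall>i<3. \<forall>j<3. i \<noteq> j \<and> [X, Y, Y] ! i = [X, Y, Y] ! j \<longrightarrow>
        t ([X, Y, Y] ! 0) ([X, Y, Y] ! 1) ([X, Y, Y] ! 2) = 0"
      unfolding diff_form_def by blast
    from this[rule_format, of 1 2] show ?thesis by simp
  qed
  have lin: "t X (Y + Z) W = t X Y W + t X Z W" "t X Y (Z + W) = t X Y Z + t X Y W"
    "t X Y (- Z) = - t X Y Z" "t X (- Y) Z = - t X Y Z" "t (- X) Y Z = - t X Y Z"
    if "X \<in> \<V>" "Y \<in> \<V>" "Z \<in> \<V>" "W \<in> \<V>" for X Y Z W
    using that torsion_scale_left[OF smooth_const, of X Y "-1"] torsion_scale_right[OF smooth_const, of Y X "-1"]
    by (simp_all add: t_def torsion_add_right metric_linear vscale_const_uminus)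
  have skew: "t X Z Y = - t X Y Z" if "X \<in> \<V>" "Y \<in> \<V>" "Z \<in> \<V>" for X Y Z
    using alt[of X "Y + Z"] alt[of X Y] alt[of X Z] that
    by (simp add: lin eq_neg_iff_add_eq_0 add.commute)
  have skew': "t Y X Z = - t X Y Z" if "X \<in> \<V>" "Y \<in> \<V>" "Z \<in> \<V>" for X Y Z
    using that by (simp add: t_def torsion_swap[of Y X] metric_linear)
  have rot: "t Y Z X = t X Y Z" "t Z X Y = t X Y Z" if "X \<in> \<V>" "Y \<in> \<V>" "Z \<in> \<V>" for X Y Z
    using that skew[of Y X Z] skew'[of X Y Z] skew[of X Y Z] skew'[of Z X Y] by auto
  have cyc: "t X Y (J Z) + t (J X) Y Z + t X (J Y) Z = 0" if "X \<in> \<V>" "Y \<in> \<V>" "Z \<in> \<V>" for X Y Z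
    using torsion_cyclic[OF that] rot[of "J X" Y Z] rot[of X "J Y" Z] that
    unfolding t_def[symmetric] by simp
  have nij: "t (J X) (J Y) Z = t X Y Z - t (J X) Y (J Z) - t X (J Y) (J Z)"
    if "X \<in> \<V>" "Y \<in> \<V>" "Z \<in> \<V>" for X Y Z
    using that by (simp add: t_def torsion_integrable metric_linear metric_J_left)
  fix Z assume Z: "Z \<in> \<V>"
  have "t X Y Z x = 0" for x
  proof -
    \<comment> \<open>The cyclic identity with \<open>J\<close> applied to each of the arguments in turn. By integrability the sum
       of the three equations is \<open>2 t X Y Z - 3 t X Y Z = 0\<close>.\<close>
    have "t (J X) Y (J Z) - t X Y Z + t (J X) (J Y) Z = 0"
      "t X (J Y) (J Z) + t (J X) (J Y) Z - t X Y Z = 0"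
      "- t X Y Z + t (J X) Y (J Z) + t X (J Y) (J Z) = 0"
      using cyc[of "J X" Y Z] cyc[of X "J Y" Z] cyc[of X Y "J Z"] assms Z by (simp_all add: lin)
    from this[THEN fun_cong, of x] nij[OF assms(2,3) Z, THEN fun_cong, of x]
    show ?thesis by (simp add: algebra_simps)
  qed
  then show "\<g> (T X Y) Z = 0" by (auto simp: t_def fun_eq_iff)
qed (use assms in simp)

text \<open>For arguments of different type both covariant derivatives are known, one from the definition of
  the Chern connection and the other from its conjugate, and their difference is the bracket. So the
  torsion vanishes on such arguments, that is \<open>T (J X) Y = T X (J Y)\<close>; integrability then makes it
  complex bilinear, and the cyclic identity excludes a nonzero bilinear torsion.\<close>

theorem (in kaehler_connection) chern_torsion_free:
  assumes chern: "chern_connection A J \<omega> D" and "X \<in> \<V>" "Y \<in> \<V>"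
  shows "T X Y = 0"
proof (rule metric_nondegenerate)
  have mixed: "T W Z = 0" if W: "W \<in> fields_01 A J" and Z: "Z \<in> fields_10 A J" for W Z
  proof -
    have V: "W \<in> \<V>" "Z \<in> \<V>" using that by (auto simp: fields_01_def fields_10_def)
    have dW: "D W Z = proj_10 J (bracket W Z)"
      using chern that by (simp add: chern_connection_def)
    have "D (conj_field Z) (conj_field W) = proj_10 J (bracket (conj_field Z) (conj_field W))"
      using chern conj_fields_01[OF Z] conj_fields_10[OF W] by (simp add: chern_connection_def)
    then have "conj_field (D (conj_field Z) (conj_field W)) = proj_01 J (bracket Z W)"
      using V by (simp add: conj_proj_10 conj_bracket)
    then have dZ: "D Z W = proj_01 J (bracket Z W)"
      using V by (simp add: D_conj)
    have "proj_01 J (bracket Z W) = - proj_01 J (bracket W Z)"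
      using V by (simp add: bracket_swap[of Z W] proj_01_def J_uminus algebra_simps)
    then show ?thesis
      using proj_sum[of "bracket W Z"] by (simp add: torsion_def dW dZ)
  qed
  have J_swap: "T (J P) Q = T P (J Q)" if "P \<in> \<V>" "Q \<in> \<V>" for P Q
  proof -
    have s: "proj_10 J P + proj_01 J P = P" "proj_10 J Q + proj_01 J Q = Q" by (rule proj_sum)+
    have "T (proj_01 J P) (proj_10 J Q) = 0" "T (proj_10 J P) (proj_01 J Q) = 0"
      using mixed proj_fields that torsion_swap[of "proj_10 J P" "proj_01 J Q"] by auto
    then have "T (J (proj_10 J P + proj_01 J P)) (proj_10 J Q + proj_01 J Q) =
          T (proj_10 J P + proj_01 J P) (J (proj_10 J Q + proj_01 J Q))"
      using that
      by (simp add: J_add J_proj_10 J_proj_01 torsion_add_left torsion_add_right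
          torsion_scale_left torsion_scale_right)
    then show ?thesis by (simp only: s)
  qed
  have J_linear: "T (J P) Q = J (T P Q)" if "P \<in> \<V>" "Q \<in> \<V>" for P Q
  proof -
    have "T (J P) (J Q) = - T P Q"
      using J_swap[of P "J Q"] torsion_scale_right[OF smooth_const, of Q P "-1"] that
      by (simp add: vscale_const_uminus)
    then have two: "- T P Q = T P Q + J (T (J P) Q) + J (T (J P) Q)"
      using torsion_integrable[OF that] J_swap[OF that] by simp
    have "J (T (J P) Q) f x = - T P Q f x" for f x
    proof -
      have "2 * (J (T (J P) Q) f x + T P Q f x) = 0"
        using two[THEN fun_cong, THEN fun_cong, of f x] by (simp add: algebra_simps)
      then show ?thesis unfolding mult_eq_0_iff by (simp add: eq_neg_iff_add_eq_0)
    qed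
    then have "J (T (J P) Q) = - T P Q" by (simp add: fun_eq_iff)
    then have "J (J (T (J P) Q)) = - J (T P Q)" using that by (simp add: J_uminus)
    then show ?thesis using that by simp
  qed
  fix Z assume Z: "Z \<in> \<V>"
  define t where "t X Y Z = \<g> (T X Y) Z" for X Y Z
  have J_left: "t (J P) Q R = - t P Q (J R)" and J_mid: "t P (J Q) R = - t P Q (J R)"
    if "P \<in> \<V>" "Q \<in> \<V>" "R \<in> \<V>" for P Q R
    using that by (simp_all add: t_def J_swap[symmetric] J_linear metric_J_left)
  have cyc: "t P Q (J R) + t Q R (J P) + t R P (J Q) = 0" if "P \<in> \<V>" "Q \<in> \<V>" "R \<in> \<V>" for P Q R
    using torsion_cyclic[OF that] by (simp add: t_def)
  have neg: "t P Q (- R) = - t P Q R" if "P \<in> \<V>" "Q \<in> \<V>" "R \<in> \<V>" for P Q R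
    using that by (simp add: t_def metric_linear)
  have "t X Y Z x = 0" for x
  proof -
    have "t X Y Z - t Y Z X + t Z X Y = 0" "t X Y Z + t Y Z X - t Z X Y = 0"
      using cyc[of "J X" Y Z] cyc[of X "J Y" Z] assms Z by (simp_all add: J_left J_mid neg)
    from this[THEN fun_cong, of x] have "t X Y Z x = - (t Z X Y x - t Y Z X x)"
      "t X Y Z x = t Z X Y x - t Y Z X x" by (simp_all add: algebra_simps)
    then have "t X Y Z x = - t X Y Z x" by metis
    then show ?thesis by (simp add: eq_neg_iff_add_eq_0 flip: mult_2)
  qed
  then show "\<g> (T X Y) Z = 0" by (auto simp: t_def fun_eq_iff)
qed (use assms in simp)

section \<open>The Levi-Civita connection\<close>

locale levi_civita = kaehler_connection +
  assumes torsion_free: "X \<in> \<V> \<Longrightarrow> Y \<in> \<V> \<Longrightarrow> torsion D X Y = 0"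
begin

lemma bracket_D: "X \<in> \<V> \<Longrightarrow> Y \<in> \<V> \<Longrightarrow> bracket X Y = D X Y - D Y X"
  using torsion_free[of X Y] by (simp add: torsion_def)

lemma koszul:
  assumes "X \<in> \<V>" "Y \<in> \<V>" "Z \<in> \<V>"
  shows "2 * \<g> (D X Y) Z = X (\<g> Y Z) + Y (\<g> Z X) - Z (\<g> X Y)
    + \<g> (bracket X Y) Z - \<g> (bracket Y Z) X + \<g> (bracket Z X) Y"
proof -
  have m: "P (\<g> Q R) = \<g> (D P Q) R + \<g> (D P R) Q" if "P \<in> \<V>" "Q \<in> \<V>" "R \<in> \<V>" for P Q R
    using that metric_sym[of "D P R" Q] by (simp add: D_metric[OF that])
  show ?thesis
    unfolding m[OF assms] m[OF assms(2,3,1)] m[OF assms(3,1,2)]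
    using assms by (simp add: bracket_D metric_linear)
qed

end

lemma levi_civita_unique:
  assumes "levi_civita A J \<omega> D" "levi_civita A J \<omega> D'"
    and V: "X \<in> vector_fields A" "Y \<in> vector_fields A"
  shows "D X Y = D' X Y"
proof -
  interpret D: levi_civita A J \<omega> D by fact
  interpret D': levi_civita A J \<omega> D' by fact
  show ?thesis
  proof (rule D.metric_eqI)
    fix Z assume Z: "Z \<in> vector_fields A"
    have "2 * metric J \<omega> (D X Y) Z = 2 * metric J \<omega> (D' X Y) Z"
      unfolding D.koszul[OF V Z] D'.koszul[OF V Z] ..
    then show "metric J \<omega> (D X Y) Z = metric J \<omega> (D' X Y) Z" by (simp add: fun_eq_iff)
  qed (use V in auto)
qed

text \<open>The Chern and the Bismut connection agree, as both are torsion-free, and a Gauduchon connection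
  is an affine combination of the two.\<close>

theorem gauduchon_levi_civita:
  assumes "kaehler_manifold A J \<omega>"
    and Ch: "chern_connection A J \<omega> D_Ch" and B: "bismut_connection A J \<omega> D_B"
  shows "levi_civita A J \<omega> (gauduchon_connection D_Ch D_B \<tau>)"
proof -
  interpret kaehler_manifold A J \<omega> by fact
  interpret Ch: kaehler_connection A J \<omega> D_Ch
    by unfold_locales (use Ch in \<open>simp add: chern_connection_def\<close>)
  interpret B: kaehler_connection A J \<omega> D_B
    by unfold_locales (use B in \<open>simp add: bismut_connection_def\<close>)
  interpret Ch: levi_civita A J \<omega> D_Ch by unfold_locales (rule Ch.chern_torsion_free[OF Ch])
  interpret B: levi_civita A J \<omega> D_B by unfold_locales (rule B.bismut_torsion_free[OF B])
  let ?D = "gauduchon_connection D_Ch D_B \<tau>"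
  have eq: "?D X Y = D_Ch X Y" if "X \<in> \<V>" "Y \<in> \<V>" for X Y
  proof -
    have "?D X Y = vscale (\<lambda>_. of_real ((1 + \<tau>) / 2)) (D_Ch X Y) + vscale (\<lambda>_. of_real ((1 - \<tau>) / 2)) (D_Ch X Y)"
      using levi_civita_unique[OF B.levi_civita_axioms Ch.levi_civita_axioms that]
      by (simp add: gauduchon_connection_def)
    then show ?thesis by (simp add: vscale_def fun_eq_iff field_simps)
  qed
  show ?thesis
  proof
    have R: "X \<in> \<R> \<Longrightarrow> X \<in> \<V>" for X by (simp add: real_field_iff)
    show "hermitian_connection A J \<omega> ?D"
      unfolding hermitian_connection_def affine_connection_def
      by (auto simp: eq R Ch.D_add_left Ch.D_add_right Ch.D_scale_left Ch.D_scale_right Ch.D_J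
          Ch.D_real Ch.D_metric)
    show "torsion ?D X Y = 0" if "X \<in> \<V>" "Y \<in> \<V>" for X Y
      using Ch.torsion_free[OF that] that by (simp add: torsion_def eq)
  qed
qed

section \<open>Curvature of almost-abelian Kaehler Lie groups\<close>

lemma (in lie_group_manifold) left_invariant_bracket [simp]:
  assumes "X \<in> \<LL>" "Y \<in> \<LL>" shows "bracket X Y \<in> \<LL>"
proof -
  have "pushforward G a (bracket X Y) = bracket (pushforward G a X) (pushforward G a Y)" for a
    by (simp add: pushforward_def bracket_def fun_eq_iff)
  then show ?thesis
    using assms by (auto simp: left_invariant_iff real_field_iff conj_bracket)
qed

definition connection_curvature :: "'g connection \<Rightarrow> 'g vf \<Rightarrow> 'g vf \<Rightarrow> 'g vf \<Rightarrow> 'g vf" where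
  "connection_curvature D X Y Z = D X (D Y Z) - D Y (D X Z) - D (bracket X Y) Z"

context metric_connection
begin

abbreviation "Curv \<equiv> connection_curvature D"

lemma D_sum_right:
  "X \<in> \<V> \<Longrightarrow> (\<And>i. i \<in> I \<Longrightarrow> Y i \<in> \<V>) \<Longrightarrow> D X (\<Sum>i\<in>I. Y i) = (\<Sum>i\<in>I. D X (Y i))"
  by (induction I rule: infinite_finite_induct) (auto simp: D_add_right)

lemma curvature_in [simp]: "X \<in> \<V> \<Longrightarrow> Y \<in> \<V> \<Longrightarrow> Z \<in> \<V> \<Longrightarrow> Curv X Y Z \<in> \<V>"
  by (simp add: connection_curvature_def)

lemma curvature_swap: "X \<in> \<V> \<Longrightarrow> Y \<in> \<V> \<Longrightarrow> Z \<in> \<V> \<Longrightarrow> Curv Y X Z = - Curv X Y Z"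
  by (simp add: connection_curvature_def bracket_swap[of Y X] D_uminus_left)

lemma curvature_add_left:
  "X \<in> \<V> \<Longrightarrow> X' \<in> \<V> \<Longrightarrow> Y \<in> \<V> \<Longrightarrow> Z \<in> \<V> \<Longrightarrow> Curv (X + X') Y Z = Curv X Y Z + Curv X' Y Z"
  by (simp add: connection_curvature_def bracket_add_left D_add_left D_add_right algebra_simps)

lemma curvature_scale_left:
  "f \<in> \<C> \<Longrightarrow> X \<in> \<V> \<Longrightarrow> Y \<in> \<V> \<Longrightarrow> Z \<in> \<V> \<Longrightarrow> Curv (vscale f X) Y Z = vscale f (Curv X Y Z)"
  by (simp add: connection_curvature_def bracket_vscale_left D_scale_left D_scale_right D_diff_left
      algebra_simps)

end

locale invariant_frame =
  lie_group_manifold G A + levi_civita A J \<omega> D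
  for G :: "('g::{t2_space, second_countable_topology}) monoid" and A :: "('g, 'n::finite) atlas"
    and J \<omega> D +
  fixes e :: "nat \<Rightarrow> 'g vf"
  assumes J_invariant: "left_invariant_endo G A J"
    and omega_invariant: "left_invariant_form G A 2 \<omega>"
    and frame: "left_invariant_orthonormal_frame G A J \<omega> e"
begin

text \<open>A name for the index set, so that simplification does not rewrite its interval bounds.\<close>

definition I :: "nat set" where "I = {1..6}"

lemma finite_indices [simp]: "finite I"
  by (simp add: I_def)

lemma frame_left_invariant [simp]: "i \<in> I \<Longrightarrow> e i \<in> \<LL>"
  using frame by (simp add: left_invariant_orthonormal_frame_def I_def)

lemma frame_in [simp]: "i \<in> I \<Longrightarrow> e i \<in> \<V>"
  by (intro left_invariant_in frame_left_invariant)

lemma frame_orthonormal: "i \<in> I \<Longrightarrow> j \<in> I \<Longrightarrow> \<g> (e i) (e j) = (if i = j then 1 else 0)"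
  using frame by (simp add: left_invariant_orthonormal_frame_def I_def)

lemma frame_coefficients:
  assumes U: "U \<in> \<V>"
  shows frame_coefficient: "i \<in> I \<Longrightarrow> (THE c. frame_expansion A e U c) i = \<g> U (e i)"
    and frame_expand: "U = (\<Sum>i\<in>I. vscale (\<g> U (e i)) (e i))"
proof -
  have ex: "\<exists>!c. frame_expansion A e U c"
    using frame U by (simp add: left_invariant_orthonormal_frame_def)
  define c where "c = (THE c. frame_expansion A e U c)"
  have "frame_expansion A e U c" unfolding c_def by (rule theI'[OF ex])
  then have c: "\<And>i. i \<in> I \<Longrightarrow> c i \<in> \<C>" and Uc: "U = (\<Sum>i\<in>I. vscale (c i) (e i))"
    by (auto simp: frame_expansion_def I_def)
  have co: "c j = \<g> U (e j)" if j: "j \<in> I" for j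
  proof -
    have "\<g> (vscale (c i) (e i)) (e j) = (if i = j then c j else 0)" if "i \<in> I" for i
      using that j c by (auto simp: metric_scale_left frame_orthonormal)
    then have "(\<Sum>i\<in>I. \<g> (vscale (c i) (e i)) (e j)) = c j"
      using j by simp
    then show ?thesis
      using j c by (subst Uc) (simp add: metric_sum_left)
  qed
  then show "i \<in> I \<Longrightarrow> (THE c. frame_expansion A e U c) i = \<g> U (e i)"
    by (simp add: c_def)
  show "U = (\<Sum>i\<in>I. vscale (\<g> U (e i)) (e i))"
    using Uc co by simp
qed

lemma frame_eqI:
  assumes "U \<in> \<V>" "W \<in> \<V>" "\<And>i. i \<in> I \<Longrightarrow> \<g> U (e i) = \<g> W (e i)"
  shows "U = W"
  using frame_expand[OF assms(1)] frame_expand[OF assms(2)] assms(3) by simp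

text \<open>Tensoriality: identities that are linear over the functions may be checked on the frame.\<close>

lemma frame_linear_zero:
  assumes add: "\<And>X Y. X \<in> \<V> \<Longrightarrow> Y \<in> \<V> \<Longrightarrow> \<phi> (X + Y) = \<phi> X + \<phi> Y"
    and scale: "\<And>f X. f \<in> \<C> \<Longrightarrow> X \<in> \<V> \<Longrightarrow> \<phi> (vscale f X) = f * \<phi> X"
    and zero: "\<And>i. i \<in> I \<Longrightarrow> \<phi> (e i) = (0 :: 'g \<Rightarrow> complex)" and X: "X \<in> \<V>"
  shows "\<phi> X = 0"
proof -
  have \<phi>0: "\<phi> 0 = 0" using scale[OF smooth_zero field_zero_in] by simp
  have sum: "\<phi> (\<Sum>i\<in>K. vscale (\<g> X (e i)) (e i)) = 0" if "K \<subseteq> I" for K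
    using finite_subset[OF that finite_indices] that
  proof (induction K rule: finite_induct)
    case (insert i K)
    then have i: "i \<in> I" and K: "\<And>k. k \<in> K \<Longrightarrow> k \<in> I" by auto
    have V: "vscale (\<g> X (e k)) (e k) \<in> \<V>" if "k \<in> I" for k using that X by simp
    have "\<phi> (\<Sum>k\<in>insert i K. vscale (\<g> X (e k)) (e k)) =
        \<phi> (vscale (\<g> X (e i)) (e i)) + \<phi> (\<Sum>k\<in>K. vscale (\<g> X (e k)) (e k))"
      unfolding sum.insert[OF insert.hyps] by (rule add[OF V[OF i] field_sum_in[OF V[OF K]]])
    also have "\<dots> = \<g> X (e i) * \<phi> (e i) + 0"
    proof (rule arg_cong2[where f="(+)"])
      show "\<phi> (vscale (\<g> X (e i)) (e i)) = \<g> X (e i) * \<phi> (e i)"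
        using X i by (intro scale) simp_all
      show "\<phi> (\<Sum>k\<in>K. vscale (\<g> X (e k)) (e k)) = 0"
        using K by (intro insert.IH) blast
    qed
    also have "\<dots> = 0" unfolding zero[OF i] by simp
    finally show ?case .
  qed (simp add: \<phi>0)
  show ?thesis using sum[OF order_refl] frame_expand[OF X] by simp
qed

lemma J_left_invariant [simp]: "X \<in> \<LL> \<Longrightarrow> J X \<in> \<LL>"
  using J_invariant J_real by (simp add: left_invariant_iff real_field_iff left_invariant_endo_def)
     (metis)

lemma metric_constant:
  assumes "X \<in> \<LL>" "Y \<in> \<LL>"
  obtains c :: real where "\<g> X Y = (\<lambda>_. of_real c)"
proof -
  have JY: "J Y \<in> \<LL>" using assms by simp
  have "[X, J Y] \<in> field_lists A 2" using assms by (simp add: field_lists_pair)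
  then have "\<g> X Y (a \<otimes>\<^bsub>G\<^esub> x) = \<g> X Y x" for a x
    using omega_invariant[unfolded left_invariant_form_def, rule_format, of "[X, J Y]" a x] assms JY
    by (simp add: metric_omega left_invariant_iff)
  then have "\<g> X Y = (\<lambda>_. \<g> X Y \<one>\<^bsub>G\<^esub>)" by (rule constant_function)
  moreover have "\<g> X Y \<one>\<^bsub>G\<^esub> \<in> \<real>" using assms by (intro metric_real) auto
  ultimately show ?thesis using that by (metis Reals_cases)
qed

lemma derivative_metric_zero:
  assumes "X \<in> \<V>" "Y \<in> \<LL>" "Z \<in> \<LL>" shows "X (\<g> Y Z) = 0"
proof -
  obtain c where "\<g> Y Z = (\<lambda>_. of_real c)" using metric_constant[OF assms(2,3)] .
  then show ?thesis using field_const[OF assms(1)] by simp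
qed

lemma koszul_left_invariant:
  assumes "X \<in> \<LL>" "Y \<in> \<LL>" "Z \<in> \<LL>"
  shows "2 * \<g> (D X Y) Z = \<g> (bracket X Y) Z - \<g> (bracket Y Z) X + \<g> (bracket Z X) Y"
  using koszul[of X Y Z] assms
    derivative_metric_zero[of X Y Z] derivative_metric_zero[of Y Z X] derivative_metric_zero[of Z X Y]
  by simp

text \<open>Each term of the Koszul formula is an inner product of left-invariant fields.\<close>

lemma connection_constant:
  assumes "X \<in> \<LL>" "Y \<in> \<LL>" "Z \<in> \<LL>"
  obtains c where "\<g> (D X Y) Z = (\<lambda>_. c)"
proof -
  obtain a :: real where a: "\<g> (bracket X Y) Z = (\<lambda>_. of_real a)"
    using metric_constant[OF left_invariant_bracket[OF assms(1,2)] assms(3)] .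
  obtain b :: real where b: "\<g> (bracket Y Z) X = (\<lambda>_. of_real b)"
    using metric_constant[OF left_invariant_bracket[OF assms(2,3)] assms(1)] .
  obtain c :: real where c: "\<g> (bracket Z X) Y = (\<lambda>_. of_real c)"
    using metric_constant[OF left_invariant_bracket[OF assms(3,1)] assms(2)] .
  have "2 * \<g> (D X Y) Z = (\<lambda>_. of_real (a - b + c))"
    using koszul_left_invariant[OF assms] by (simp add: a b c fun_eq_iff)
  then have "\<g> (D X Y) Z = (\<lambda>_. of_real (a - b + c) / 2)"
    by (auto simp: fun_eq_iff field_simps)
  then show ?thesis by (rule that)
qed

lemma connection_form_value:
  "i \<in> I \<Longrightarrow> j \<in> I \<Longrightarrow> X \<in> \<V> \<Longrightarrow> conn_form A e D i j [X] = \<g> (D X (e j)) (e i)"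
  by (simp add: conn_form_def frame_coefficient)

lemma metric_frame_sum:
  assumes "U \<in> \<V>" "W \<in> \<V>"
  shows "\<g> U W = (\<Sum>k\<in>I. \<g> U (e k) * \<g> (e k) W)"
proof -
  have "\<g> U W = \<g> (\<Sum>k\<in>I. vscale (\<g> U (e k)) (e k)) W"
    using frame_expand[OF assms(1)] by simp
  also have "\<dots> = (\<Sum>k\<in>I. \<g> U (e k) * \<g> (e k) W)"
    using assms by (simp add: metric_sum_left metric_scale_left)
  finally show ?thesis .
qed

text \<open>Cartan's structure equation: the quadratic term in the connection forms comes from differentiating
  the inner product of \<open>D Q (e j)\<close> with \<open>e i\<close>.\<close>

lemma curvature_form_value:
  assumes ij: "i \<in> I" "j \<in> I" and XY: "X \<in> \<V>" "Y \<in> \<V>"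
  shows "curv_form A e D i j [X, Y] = \<g> (Curv X Y (e j)) (e i)"
proof -
  let ?s = "\<lambda>i j X. \<g> (D X (e j)) (e i)"
  have second: "\<g> (D P (D Q (e j))) (e i) = P (?s i j Q) + (\<Sum>k\<in>I. ?s i k P * ?s k j Q)"
    if V: "P \<in> \<V>" "Q \<in> \<V>" for P Q
  proof -
    have "\<g> (e k) (D P (e i)) = - ?s i k P" if "k \<in> I" for k
      using D_metric[OF V(1), of "e k" "e i"] derivative_metric_zero[OF V(1), of "e k" "e i"] that ij
      by (simp add: eq_neg_iff_add_eq_0 add.commute)
    then have "\<g> (D Q (e j)) (D P (e i)) = - (\<Sum>k\<in>I. ?s i k P * ?s k j Q)"
      using metric_frame_sum[of "D Q (e j)" "D P (e i)"] V ij
      by (simp add: mult.commute flip: sum_negf)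
    then show ?thesis
      using D_metric[OF V(1), of "D Q (e j)" "e i"] V ij by simp
  qed
  have "curv_form A e D i j [X, Y] =
      X (?s i j Y) - Y (?s i j X) - ?s i j (bracket X Y) +
      (\<Sum>k\<in>I. ?s i k X * ?s k j Y - ?s i k Y * ?s k j X)"
    unfolding curv_form_def I_def[symmetric] using ij XY
    by (simp add: ext_deriv_1 sum_fun_apply wedge_1_1[simplified] connection_form_value)
  also have "\<dots> = \<g> (Curv X Y (e j)) (e i)"
    using ij XY
    by (simp add: connection_curvature_def metric_diff_left second sum_subtractf)
  finally show ?thesis .
qed

text \<open>The ideal is the kernel of a linear form on the Lie algebra. The vector \<open>W\<close> that represents this
  form with respect to the metric is orthogonal to the ideal, and \<open>N\<close> is \<open>W\<close> scaled to unit length.\<close>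

lemma abelian_ideal_normal:
  assumes "almost_abelian G A"
  obtains N where "N \<in> \<LL>" "\<g> N N = 1"
    and "\<And>X Y. X \<in> \<LL> \<Longrightarrow> Y \<in> \<LL> \<Longrightarrow> \<g> N Y = 0 \<Longrightarrow> \<g> N (bracket X Y) = 0"
    and "\<And>X Y. X \<in> \<LL> \<Longrightarrow> Y \<in> \<LL> \<Longrightarrow> \<g> N X = 0 \<Longrightarrow> \<g> N Y = 0 \<Longrightarrow> bracket X Y = 0"
proof -
  let ?s = "\<lambda>c::real. vscale (\<lambda>_. of_real c)"
  obtain \<hh> Y\<^sub>0 where sub: "\<hh> \<subseteq> \<LL>" and zero: "0 \<in> \<hh>"
    and add: "\<And>X Y. X \<in> \<hh> \<Longrightarrow> Y \<in> \<hh> \<Longrightarrow> X + Y \<in> \<hh>"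
    and scale: "\<And>X c. X \<in> \<hh> \<Longrightarrow> ?s c X \<in> \<hh>"
    and ideal: "\<And>X Y. X \<in> \<LL> \<Longrightarrow> Y \<in> \<hh> \<Longrightarrow> bracket X Y \<in> \<hh>"
    and abelian: "\<And>X Y. X \<in> \<hh> \<Longrightarrow> Y \<in> \<hh> \<Longrightarrow> bracket X Y = 0"
    and Y\<^sub>0: "Y\<^sub>0 \<in> \<LL>" "Y\<^sub>0 \<notin> \<hh>"
    and gen: "\<And>X. X \<in> \<LL> \<Longrightarrow> \<exists>c. \<exists>H\<in>\<hh>. X = ?s c Y\<^sub>0 + H"
    using assms unfolding almost_abelian_def by (auto simp: Bex_def)
  have s_add: "?s (a + b) X = ?s a X + ?s b X" and s_s: "?s a (?s b X) = ?s (a * b) X"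
    and s_m1: "?s (-1) X = - X" and s_0: "?s 0 X = 0" for a b X
    by (simp_all add: vscale_def fun_eq_iff algebra_simps)
  have uniq: "c = d" if eq: "?s c Y\<^sub>0 + H = ?s d Y\<^sub>0 + K" and HK: "H \<in> \<hh>" "K \<in> \<hh>" for c d H K
  proof (rule ccontr)
    assume "c \<noteq> d"
    have "K + ?s (-1) H \<in> \<hh>" using add scale HK by blast
    moreover have "K + ?s (-1) H = ?s (c - d) Y\<^sub>0"
    proof -
      have "?s (c - d) Y\<^sub>0 = ?s c Y\<^sub>0 - ?s d Y\<^sub>0" by (simp add: vscale_def fun_eq_iff algebra_simps)
      moreover have "?s c Y\<^sub>0 = ?s d Y\<^sub>0 + K - H"
        using eq by (metis add_diff_cancel_right')
      ultimately show ?thesis unfolding s_m1 by simp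
    qed
    ultimately have "?s (1 / (c - d)) (?s (c - d) Y\<^sub>0) \<in> \<hh>" using scale by metis
    then have "?s 1 Y\<^sub>0 \<in> \<hh>" unfolding s_s using \<open>c \<noteq> d\<close> by simp
    then show False using Y\<^sub>0 by simp
  qed
  \<comment> \<open>the linear form that vanishes on the ideal and is 1 on \<open>Y\<^sub>0\<close>\<close>
  define lam where "lam X = (THE c. \<exists>H\<in>\<hh>. X = ?s c Y\<^sub>0 + H)" for X
  have lam: "lam (?s c Y\<^sub>0 + H) = c" if "H \<in> \<hh>" for c H
    unfolding lam_def using that uniq by (intro the_equality) blast+
  have lam_dec: "\<exists>H\<in>\<hh>. X = ?s (lam X) Y\<^sub>0 + H" if "X \<in> \<LL>" for X
    using gen[OF that] lam by metis
  have lam_add: "lam (X + Y) = lam X + lam Y" if X: "X \<in> \<LL>" and Y: "Y \<in> \<LL>" for X Y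
  proof -
    obtain H K where HK: "H \<in> \<hh>" "K \<in> \<hh>" "X = ?s (lam X) Y\<^sub>0 + H" "Y = ?s (lam Y) Y\<^sub>0 + K"
      using lam_dec[OF X] lam_dec[OF Y] by metis
    have "X + Y = ?s (lam X + lam Y) Y\<^sub>0 + (H + K)"
      by (subst HK(3), subst HK(4)) (simp only: s_add ac_simps)
    then show ?thesis using lam add HK by metis
  qed
  have lam_scale: "lam (?s c X) = c * lam X" if X: "X \<in> \<LL>" for c X
  proof -
    obtain H where H: "H \<in> \<hh>" "X = ?s (lam X) Y\<^sub>0 + H"
      using lam_dec[OF X] by metis
    have "?s c X = ?s (c * lam X) Y\<^sub>0 + ?s c H"
      by (subst H(2)) (simp only: s_s vf.scale_right_distrib)
    then show ?thesis using lam scale H by metis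
  qed
  have lam_h: "lam X = 0 \<longleftrightarrow> X \<in> \<hh>" if "X \<in> \<LL>" for X
  proof
    assume "lam X = 0"
    then show "X \<in> \<hh>" using lam_dec[OF that] s_0 by (metis add_0)
  next
    assume "X \<in> \<hh>"
    then show "lam X = 0" using lam[of X 0] unfolding s_0 by simp
  qed
  have lam_sum: "lam (\<Sum>i\<in>K. X i) = (\<Sum>i\<in>K. lam (X i))" if "\<And>i. i \<in> K \<Longrightarrow> X i \<in> \<LL>" for K and X :: "nat \<Rightarrow> 'g vf"
    using that zero lam_h[OF left_invariant_zero]
    by (induction K rule: infinite_finite_induct) (auto simp: lam_add)
  define W where "W = (\<Sum>i\<in>I. ?s (lam (e i)) (e i))"
  have W: "W \<in> \<LL>" unfolding W_def by (intro left_invariant_sum left_invariant_scale) simp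
  have gW: "\<g> W X = (\<lambda>_. of_real (lam X))" if X: "X \<in> \<LL>" for X
  proof -
    have "\<exists>c. \<forall>i\<in>I. \<g> X (e i) = (\<lambda>_. of_real (c i))"
      by (intro bchoice ballI) (metis metric_constant X frame_left_invariant)
    then obtain c :: "nat \<Rightarrow> real" where c: "\<And>i. i \<in> I \<Longrightarrow> \<g> X (e i) = (\<lambda>_. of_real (c i))" by blast
    have "X = (\<Sum>i\<in>I. ?s (c i) (e i))" using frame_expand[of X] X c by simp
    then have "lam X = (\<Sum>i\<in>I. c i * lam (e i))" by (simp add: lam_sum lam_scale)
    moreover have "\<g> W X = (\<Sum>i\<in>I. (\<lambda>_. of_real (lam (e i) * c i)))"
      unfolding W_def using X c
      by (simp add: metric_sum_left metric_scale_left metric_sym[of X "e _"] times_fun_def)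
    ultimately show ?thesis by (simp add: fun_eq_iff sum_fun_apply mult.commute)
  qed
  have gWW: "lam W = (\<Sum>i\<in>I. (lam (e i))\<^sup>2)"
    unfolding W_def by (simp add: lam_sum lam_scale power2_eq_square)
  \<comment> \<open>otherwise \<open>lam\<close> would be zero on the whole frame\<close>
  have "lam W \<noteq> 0"
  proof
    assume "lam W = 0"
    then have "lam (e i) = 0" if "i \<in> I" for i
      using gWW that by (simp add: sum_nonneg_eq_0_iff)
    then have "W = 0" unfolding W_def
      by (intro sum.neutral ballI) (simp only: s_0)
    then have "(0 :: 'g \<Rightarrow> complex) = (\<lambda>_. of_real (lam Y\<^sub>0))"
      using gW[OF Y\<^sub>0(1)] metric_zero_left[OF left_invariant_in[OF Y\<^sub>0(1)]] by metis
    then have "lam Y\<^sub>0 = 0" by (simp add: fun_eq_iff)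
    then show False using lam_h Y\<^sub>0 by blast
  qed
  moreover have "lam W \<ge> 0" unfolding gWW by (intro sum_nonneg) simp
  ultimately have pos: "lam W > 0" by simp
  define N where "N = ?s (1 / sqrt (lam W)) W"
  have N: "N \<in> \<LL>" unfolding N_def by (intro left_invariant_scale W)
  have gN: "\<g> N X = (\<lambda>_. of_real (lam X / sqrt (lam W)))" if "X \<in> \<LL>" for X
    unfolding N_def using that W by (simp add: metric_scale_left gW fun_eq_iff)
  have gN0: "\<g> N X = 0 \<longleftrightarrow> X \<in> \<hh>" if "X \<in> \<LL>" for X
    using gN[OF that] lam_h[OF that] pos by (simp add: fun_eq_iff)
  show ?thesis
  proof (rule that[OF N])
    have "lam N = 1 / sqrt (lam W) * lam W" unfolding N_def by (rule lam_scale[OF W])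
    also have "\<dots> = sqrt (lam W)" using pos by (simp add: real_div_sqrt)
    finally show "\<g> N N = 1" using gN[OF N] pos by (simp add: fun_eq_iff)
  qed (use gN0 ideal abelian sub in auto)
qed

end

locale abelian_ideal_frame = invariant_frame +
  fixes N
  assumes N [simp]: "N \<in> \<LL>" and N_unit: "\<g> N N = 1"
    and ideal: "X \<in> \<LL> \<Longrightarrow> Y \<in> \<LL> \<Longrightarrow> \<g> N Y = 0 \<Longrightarrow> \<g> N (bracket X Y) = 0"
    and abelian: "X \<in> \<LL> \<Longrightarrow> Y \<in> \<LL> \<Longrightarrow> \<g> N X = 0 \<Longrightarrow> \<g> N Y = 0 \<Longrightarrow> bracket X Y = 0"
begin

abbreviation "M \<equiv> J N"

definition "\<H> = {X \<in> \<LL>. \<g> N X = 0}"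

text \<open>The largest complex subspace of the ideal \<open>\<H>\<close>.\<close>

definition "\<H>\<^sub>J = {X \<in> \<LL>. \<g> N X = 0 \<and> \<g> M X = 0}"

lemma ideal_left_invariant: "X \<in> \<H> \<Longrightarrow> X \<in> \<LL>" "X \<in> \<H>\<^sub>J \<Longrightarrow> X \<in> \<LL>" "X \<in> \<H>\<^sub>J \<Longrightarrow> X \<in> \<H>"
  by (auto simp: \<H>_def \<H>\<^sub>J_def)

lemma ideal_in [simp]: "X \<in> \<H> \<Longrightarrow> X \<in> \<V>" "X \<in> \<H>\<^sub>J \<Longrightarrow> X \<in> \<V>"
  by (auto simp: \<H>_def \<H>\<^sub>J_def)

lemma N_in [simp]: "N \<in> \<V>"
  by (rule left_invariant_in[OF N])

lemma N_M: "\<g> N M = 0" "\<g> M N = 0" and M_unit: "\<g> M M = 1"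
  using metric_J_orthogonal[OF N_in] metric_sym[of N M] by (simp_all add: metric_J_J N_unit)

lemma M_ideal: "M \<in> \<H>"
  by (simp add: \<H>_def N_M)

lemma J_ideal: assumes "X \<in> \<H>\<^sub>J" shows "J X \<in> \<H>\<^sub>J"
  using assms metric_J_left[of N X] by (auto simp: \<H>\<^sub>J_def metric_J_J)

lemma normal_decomposition:
  assumes "X \<in> \<LL>"
  obtains c :: real and X' where "X' \<in> \<H>" "X = X' + vscale (\<lambda>_. of_real c) N"
proof -
  obtain c :: real where c: "\<g> N X = (\<lambda>_. of_real c)" using metric_constant[OF N assms] .
  show ?thesis
  proof
    have "X + vscale (\<lambda>_. of_real (- c)) N = X - vscale (\<lambda>_. of_real c) N"
      by (simp add: vscale_const_uminus)
    moreover have "X + vscale (\<lambda>_. of_real (- c)) N \<in> \<LL>"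
      by (intro left_invariant_add left_invariant_scale N assms)
    ultimately have "X - vscale (\<lambda>_. of_real c) N \<in> \<LL>" by metis
    then show "X - vscale (\<lambda>_. of_real c) N \<in> \<H>"
      using assms by (simp add: \<H>_def metric_linear c N_unit)
  qed simp
qed

text \<open>The frame is tested on its components normal to and inside the ideal.\<close>

lemma parallel_normal:
  assumes U: "U \<in> \<V>" and orth: "\<And>Z. Z \<in> \<H> \<Longrightarrow> \<g> U Z = 0"
  shows "U = vscale (\<g> U N) N"
proof (rule frame_eqI)
  fix i assume i: "i \<in> I"
  obtain c :: real and Z where Z: "Z \<in> \<H>" "e i = Z + vscale (\<lambda>_. of_real c) N"
    using normal_decomposition[OF frame_left_invariant[OF i]] .
  have "\<g> N Z = 0" using Z by (simp add: \<H>_def)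
  then show "\<g> U (e i) = \<g> (vscale (\<g> U N) N) (e i)"
    unfolding Z(2) using U Z orth[OF Z(1)] by (simp add: metric_linear N_unit mult.commute)
qed (use U in simp_all)

text \<open>All brackets in the Koszul formula vanish when the third field is taken in the ideal as well.\<close>

lemma D_ideal:
  assumes "X \<in> \<H>" "Y \<in> \<H>" shows "D X Y = vscale (\<g> (D X Y) N) N"
proof (rule parallel_normal)
  fix Z assume "Z \<in> \<H>"
  then have "2 * \<g> (D X Y) Z = 0"
    using koszul_left_invariant[of X Y Z] assms abelian by (auto simp: \<H>_def)
  then show "\<g> (D X Y) Z = 0" by (simp add: fun_eq_iff)
qed (use assms in simp)

text \<open>Both \<open>D X Y\<close> and \<open>J (D X Y) = D X (J Y)\<close> are multiples of \<open>N\<close>, while \<open>J N\<close> is orthogonal to \<open>N\<close>.\<close>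

lemma D_ideal_complex:
  assumes X: "X \<in> \<H>" and Y: "Y \<in> \<H>\<^sub>J" shows "D X Y = 0"
proof -
  have JY: "J Y \<in> \<H>" and YH: "Y \<in> \<H>" using Y J_ideal by (auto intro: ideal_left_invariant)
  define f h where "f = \<g> (D X Y) N" and "h = \<g> (D X (J Y)) N"
  have fh: "f \<in> \<C>" "h \<in> \<C>" using X Y by (simp_all add: f_def h_def)
  have "J (D X Y) = vscale f M" using D_ideal[OF X YH] fh by (metis J_vscale N_in f_def)
  moreover have "J (D X Y) = vscale h N"
    using D_ideal[OF X JY] X Y D_J[of X Y] by (simp add: h_def)
  ultimately have "\<g> (vscale f M) M = \<g> (vscale h N) M" by simp
  then have "f = 0" using fh by (simp add: metric_scale_left N_M M_unit)
  then show ?thesis using D_ideal[OF X YH] by (simp add: f_def)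
qed

text \<open>On the ideal itself this is the symmetry \<open>D Y Z = D Z Y\<close>. It extends to the normal direction
  because \<open>J (D Y N) = D Y M\<close> and \<open>M\<close> lies in the ideal.\<close>

lemma D_complex_ideal:
  assumes Y: "Y \<in> \<H>\<^sub>J" and X: "X \<in> \<LL>" shows "D Y X = 0"
proof -
  have ideal: "D Y Z = 0" if "Z \<in> \<H>" for Z
  proof -
    have "bracket Y Z = 0" using that Y by (intro abelian) (auto simp: \<H>_def \<H>\<^sub>J_def)
    then show ?thesis using bracket_D[of Y Z] D_ideal_complex[OF that Y] that Y by simp
  qed
  have "J (J (D Y N)) = 0"
    using ideal[OF M_ideal] D_J[of Y N] Y J_vscale[OF smooth_zero, of 0] by simp
  then have "D Y N = 0" using Y by simp
  moreover obtain c :: real and X' where "X' \<in> \<H>" "X = X' + vscale (\<lambda>_. of_real c) N"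
    using normal_decomposition[OF X] .
  ultimately show ?thesis using Y ideal by (simp add: D_add_right D_const_right)
qed

text \<open>Of the three terms in \<open>D X (D Y Z) - D Y (D X Z) - D [X,Y] Z\<close>, the first two vanish because \<open>D Y\<close>
  annihilates left-invariant fields. So does the third: \<open>[X,Y]\<close> is zero for \<open>X\<close> in the ideal, and
  \<open>[N,Y] = D N Y\<close> is again in the complex subspace, as \<open>g(M, D N Y) = - g(N, D N (J Y)) = - g(N, [N, J Y])\<close>.\<close>

lemma curvature_complex_ideal:
  assumes X: "X \<in> \<LL>" and Y: "Y \<in> \<H>\<^sub>J" and Z: "Z \<in> \<LL>"
  shows "Curv X Y Z = 0"
proof -
  have DD: "D Y (D P Z) = 0" if P: "P \<in> \<LL>" for P
  proof -
    have "D Y (vscale (\<g> (D P Z) (e i)) (e i)) = 0" if i: "i \<in> I" for i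
    proof -
      obtain c where "\<g> (D P Z) (e i) = (\<lambda>_. c)"
        using connection_constant[OF P Z frame_left_invariant[OF i]] .
      then show ?thesis using Y i by (simp add: D_const_right D_complex_ideal)
    qed
    then have "D Y (\<Sum>i\<in>I. vscale (\<g> (D P Z) (e i)) (e i)) = 0"
      using Y P Z by (simp add: D_sum_right)
    then show ?thesis using frame_expand[of "D P Z"] P Z by simp
  qed
  have H: "Curv P Y Z = 0" if P: "P \<in> \<H>" for P
  proof -
    have "bracket P Y = 0" using P Y by (intro abelian) (auto simp: \<H>_def \<H>\<^sub>J_def)
    then show ?thesis
      using DD[of P] P Y Z by (simp add: connection_curvature_def D_complex_ideal ideal_left_invariant)
  qed
  have DN: "D N Q = bracket N Q" if "Q \<in> \<H>\<^sub>J" for Q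
    using bracket_D[of N Q] D_complex_ideal[OF that N] that by simp
  have "bracket N Y \<in> \<H>\<^sub>J"
  proof -
    have "\<g> N (bracket N Y) = 0" "\<g> N (bracket N (J Y)) = 0"
      using ideal[OF N, of Y] ideal[OF N, of "J Y"] Y J_ideal[OF Y] by (auto simp: \<H>\<^sub>J_def)
    moreover have "\<g> M (bracket N Y) = - \<g> N (bracket N (J Y))"
      using metric_J_left[of N "D N Y"] D_J[of N Y] Y J_ideal[OF Y] by (simp flip: DN)
    ultimately show ?thesis using Y by (simp add: \<H>\<^sub>J_def)
  qed
  then have "Curv N Y Z = 0"
    using DD[OF N] Y Z by (simp add: connection_curvature_def D_complex_ideal)
  moreover obtain c :: real and X' where "X' \<in> \<H>" "X = X' + vscale (\<lambda>_. of_real c) N"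
    using normal_decomposition[OF X] .
  ultimately show ?thesis using Y Z H by (simp add: curvature_add_left curvature_scale_left)
qed

text \<open>A 2-form that vanishes when contracted with the orthogonal complement of the plane of \<open>N\<close> and \<open>M\<close> is
  a multiple of the area form of that plane.\<close>

lemma two_form_normal_plane:
  assumes add: "\<And>X Y Z. X \<in> \<V> \<Longrightarrow> Y \<in> \<V> \<Longrightarrow> Z \<in> \<V> \<Longrightarrow> B (X + Y) Z = B X Z + B Y Z"
    and scale: "\<And>f X Z. f \<in> \<C> \<Longrightarrow> X \<in> \<V> \<Longrightarrow> Z \<in> \<V> \<Longrightarrow> B (vscale f X) Z = f * B X Z"
    and swap: "\<And>X Y. X \<in> \<V> \<Longrightarrow> Y \<in> \<V> \<Longrightarrow> B Y X = - (B X Y :: 'a \<Rightarrow> complex)"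
    and zero: "\<And>X Y. X \<in> \<LL> \<Longrightarrow> Y \<in> \<H>\<^sub>J \<Longrightarrow> B X Y = 0"
    and V: "X \<in> \<V>" "Y \<in> \<V>"
  shows "B X Y = (\<g> X N * \<g> Y M - \<g> X M * \<g> Y N) * B N M"
proof -
  have add': "B Z (X + Y) = B Z X + B Z Y" if "X \<in> \<V>" "Y \<in> \<V>" "Z \<in> \<V>" for X Y Z
    using that add[OF that] swap[of "X + Y" Z] swap[of X Z] swap[of Y Z] by simp
  have scale': "B Z (vscale f X) = f * B Z X" if "f \<in> \<C>" "X \<in> \<V>" "Z \<in> \<V>" for f X Z
    using that scale[OF that] swap[of "vscale f X" Z] swap[of X Z] by simp
  \<comment> \<open>the value of \<open>B\<close> on \<open>Z\<close> and the component of \<open>X\<close> orthogonal to the plane\<close>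
  define \<phi> where "\<phi> Z X = B Z X - \<g> X N * B Z N - \<g> X M * B Z M" for Z X
  \<comment> \<open>For members of the frame this component is left-invariant, so the hypothesis applies.\<close>
  have frame_zero: "\<phi> (e l) (e k) = 0" if k: "k \<in> I" and l: "l \<in> I" for k l
  proof -
    obtain a :: real where a: "\<g> (e k) N = (\<lambda>_. of_real a)"
      using metric_constant[OF frame_left_invariant[OF k] N] .
    obtain b :: real where b: "\<g> (e k) M = (\<lambda>_. of_real b)"
      using metric_constant[OF frame_left_invariant[OF k] J_left_invariant[OF N]] .
    let ?P = "e k + vscale (\<lambda>_. of_real (- a)) N + vscale (\<lambda>_. of_real (- b)) M"
    have "?P \<in> \<LL>" by (intro left_invariant_add left_invariant_scale N J_left_invariant frame_left_invariant k)
    moreover have "\<g> N ?P = 0" "\<g> M ?P = 0"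
      using k metric_sym[of N "e k"] metric_sym[of M "e k"]
      by (simp_all add: metric_linear a b N_unit N_M M_unit vscale_const_uminus)
    ultimately have "B (e l) ?P = 0" using l by (intro zero) (simp_all add: \<H>\<^sub>J_def)
    then have "B (e l) (e k) + (\<lambda>_. of_real (- a)) * B (e l) N + (\<lambda>_. of_real (- b)) * B (e l) M = 0"
      using k l by (simp only: add' scale' smooth_const N_in J_in field_add_in field_vscale_in frame_in)
    then show ?thesis by (simp add: \<phi>_def a b fun_eq_iff)
  qed
  have left_zero: "\<phi> Z (e k) = 0" if k: "k \<in> I" and Z: "Z \<in> \<V>" for k Z
  proof (rule frame_linear_zero[of "\<lambda>Z. \<phi> Z (e k)", OF _ _ frame_zero[OF k] Z])
    show "\<phi> (P + Q) (e k) = \<phi> P (e k) + \<phi> Q (e k)" if "P \<in> \<V>" "Q \<in> \<V>" for P Q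
      using that k unfolding \<phi>_def by (simp add: add ring_distribs)
    show "\<phi> (vscale f P) (e k) = f * \<phi> P (e k)" if "f \<in> \<C>" "P \<in> \<V>" for f P
      using that k unfolding \<phi>_def by (simp add: scale ring_distribs ac_simps)
  qed
  have zero': "\<phi> Z X = 0" if X: "X \<in> \<V>" and Z: "Z \<in> \<V>" for X Z
  proof (rule frame_linear_zero[of "\<phi> Z", OF _ _ left_zero[OF _ Z] X])
    show "\<phi> Z (P + Q) = \<phi> Z P + \<phi> Z Q" if "P \<in> \<V>" "Q \<in> \<V>" for P Q
      using that Z unfolding \<phi>_def by (simp add: add' metric_linear ring_distribs)
    show "\<phi> Z (vscale f P) = f * \<phi> Z P" if "f \<in> \<C>" "P \<in> \<V>" for f P
      using that Z unfolding \<phi>_def by (simp add: scale' metric_linear ring_distribs ac_simps)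
  qed
  have B: "B Z X = \<g> X N * B Z N + \<g> X M * B Z M" if "X \<in> \<V>" "Z \<in> \<V>" for X Z
    using zero'[OF that] unfolding \<phi>_def by (simp add: algebra_simps)
  have alt: "B Z Z = 0" if "Z \<in> \<V>" for Z
  proof
    fix x
    have "B Z Z x = - B Z Z x" by (subst swap[OF that that]) simp
    then show "B Z Z x = 0 x" by (simp add: eq_neg_iff_add_eq_0 flip: mult_2)
  qed
  have MN: "B M N = - B N M" by (rule swap) simp_all
  have XN: "B X N = - (\<g> X M * B N M)" "B X M = \<g> X N * B N M"
    using swap[of X N] swap[of X M] B[of X N] B[of X M] V alt[of N] alt[of M] MN by simp_all
  show ?thesis
    using B[OF V(2,1)] unfolding XN by (simp add: algebra_simps)
qed

text \<open>The form \<open>B\<close> is decomposable, and for such a form the three products in its square cancel.\<close>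

lemma curvature_form_square:
  assumes ij: "i \<in> I" "j \<in> I" and V: "a \<in> \<V>" "b \<in> \<V>" "c \<in> \<V>" "d \<in> \<V>"
  shows "wedge 2 2 (curv_form A e D i j) (curv_form A e D i j) [a, b, c, d] = 0"
proof -
  define B where "B X Y = \<g> (Curv X Y (e j)) (e i)" for X Y
  define \<kappa> where "\<kappa> = B N M"
  have swap: "B Y X = - B X Y" if "X \<in> \<V>" "Y \<in> \<V>" for X Y
    using that ij by (simp add: B_def curvature_swap[of X Y] metric_linear)
  have B: "B X Y = (\<g> X N * \<g> Y M - \<g> X M * \<g> Y N) * \<kappa>" if "X \<in> \<V>" "Y \<in> \<V>" for X Y
    unfolding \<kappa>_def
  proof (rule two_form_normal_plane[OF _ _ swap _ that])
    show "B (P + Q) R = B P R + B Q R" if "P \<in> \<V>" "Q \<in> \<V>" "R \<in> \<V>" for P Q R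
      using that ij by (simp add: B_def curvature_add_left metric_linear)
    show "B (vscale f P) R = f * B P R" if "f \<in> \<C>" "P \<in> \<V>" "R \<in> \<V>" for f P R
      using that ij by (simp add: B_def curvature_scale_left metric_linear)
    show "B P Q = 0" if "P \<in> \<LL>" "Q \<in> \<H>\<^sub>J" for P Q
      using that ij by (simp add: B_def curvature_complex_ideal)
  qed
  have val: "curv_form A e D i j [X, Y] = B X Y" if "X \<in> {a, b, c, d}" "Y \<in> {a, b, c, d}" for X Y
    using that V ij by (auto simp: B_def curvature_form_value)
  have "wedge 2 2 (curv_form A e D i j) (curv_form A e D i j) [a, b, c, d] =
      (\<lambda>_. 2) * (B a b * B c d - B a c * B b d + B a d * B b c)"
  proof (subst wedge_2_2_square)
    fix X Y assume XY: "X \<in> {a, b, c, d}" "Y \<in> {a, b, c, d}"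
    then have "X \<in> \<V>" "Y \<in> \<V>" using V by auto
    then show "curv_form A e D i j [Y, X] = - curv_form A e D i j [X, Y]"
      unfolding val[OF XY] val[OF XY(2,1)] by (rule swap)
  qed (simp add: val)
  also have "\<dots> = 0"
    using V by (simp add: B algebra_simps)
  finally show ?thesis .
qed

end

theorem (in invariant_frame) trace_curvature_squared:
  assumes "almost_abelian G A"
  shows "form_eq A 4 (tr_curv_sq A e D) 0"
proof -
  obtain N where N: "N \<in> \<LL>" "\<g> N N = 1"
    "\<And>X Y. X \<in> \<LL> \<Longrightarrow> Y \<in> \<LL> \<Longrightarrow> \<g> N Y = 0 \<Longrightarrow> \<g> N (bracket X Y) = 0"
    "\<And>X Y. X \<in> \<LL> \<Longrightarrow> Y \<in> \<LL> \<Longrightarrow> \<g> N X = 0 \<Longrightarrow> \<g> N Y = 0 \<Longrightarrow> bracket X Y = 0"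
    using abelian_ideal_normal[OF assms] by blast
  interpret abelian_ideal_frame G A J \<omega> D e N
    by unfold_locales (use N in blast)+
  have "tr_curv_sq A e D Xs = 0" if Xs: "Xs \<in> field_lists A 4" for Xs
  proof -
    obtain a b c d where Xs: "Xs = [a, b, c, d]" "a \<in> \<V>" "b \<in> \<V>" "c \<in> \<V>" "d \<in> \<V>"
      using field_lists_4E[OF Xs] .
    show ?thesis
      unfolding tr_curv_sq_def Xs(1)
      by (rule ext, simp only: sum_fun_apply)
         (simp add: curvature_form_square Xs(2-) I_def)
  qed
  then show ?thesis by (simp add: form_eq_def)
qed

section \<open>Flat bundles\<close>

text \<open>Flatness only concerns sections, but by definition the curvature is zero on all other maps. This
  lets \<open>F\<close> be composed with itself without asking whether zero is a section.\<close>

lemma flat_bundle_curvature: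
  assumes "endo_form_zero A \<Gamma> 2 (bundle_curvature \<Gamma> D)" "Xs \<in> field_lists A 2"
  shows "bundle_curvature \<Gamma> D Xs s = 0"
  using assms by (cases "s \<in> \<Gamma>") (auto simp: endo_form_zero_def bundle_curvature_def)

context complex_manifold
begin

lemma flat_wedge_endo:
  assumes "vector_space scl" and F: "\<And>Ys s. Ys \<in> field_lists A q \<Longrightarrow> F Ys s = 0"
  shows "endo_form_zero A \<Gamma> (p + q) (wedge_endo scl p q \<alpha> F)"
proof -
  interpret vector_space scl by fact
  show ?thesis
    unfolding endo_form_zero_def wedge_endo_def
    by (auto simp: F[OF field_lists_permute(2)] fun_eq_iff intro!: sum.neutral)
qed

lemma flat_type_part:
  assumes F: "\<And>Ys s. Ys \<in> field_lists A (p + q) \<Longrightarrow> F Ys s = 0"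
  shows "endo_form_zero A \<Gamma> (p + q) (type_part J p q F)"
  using type_part_zero[of p q F] F by (simp add: endo_form_zero_def fun_eq_iff)

lemma flat_trace_form:
  assumes "vector_space scl" and F: "\<And>Ys s. Ys \<in> field_lists A 2 \<Longrightarrow> F Ys s = 0"
    and Xs: "Xs \<in> field_lists A 4"
  shows "trace_form scl E \<Gamma> (endo_wedge_endo scl 2 2 F F) Xs x = 0"
proof -
  interpret vector_space scl by fact
  have "endo_wedge_endo scl 2 2 F F Xs s = 0" for s
    using field_lists_permute[of Xs 2 2] Xs
    by (auto simp: endo_wedge_endo_def fun_eq_iff F intro!: sum.neutral)
  then show ?thesis
    by (simp add: trace_form_def Let_def fibre_endo_def representation_zero)
qed

end

section \<open>The Hull-Strominger system\<close>

theorem proposition3p2: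
  fixes G :: "('g::{t2_space, second_countable_topology}) monoid"
    and A :: "('g, 6) atlas"
    and J :: "'g vf \<Rightarrow> 'g vf"
    and \<omega> \<Psi> :: "'g form"
    and scl :: "complex \<Rightarrow> 'v::ab_group_add \<Rightarrow> 'v"
    and r :: nat
    and E :: "'g \<Rightarrow> 'v set"
    and \<Phi> :: "('g, 'v) local_frames"
    and D_E :: "'g vf \<Rightarrow> ('g \<Rightarrow> 'v) \<Rightarrow> ('g \<Rightarrow> 'v)"
    and \<Gamma> :: "('g \<Rightarrow> 'v) set"
    and F :: "('g, 'v) endo_form"
    and D_Ch D_B :: "'g connection"
    and \<tau> \<alpha>' :: real
  assumes "lie_group G A" and "almost_abelian G A"
    and "left_invariant_kaehler G A J \<omega>"
    and "holomorphic_volume_form A J \<Psi>" and "left_invariant_form G A 3 \<Psi>"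
    and "holomorphic_bundle A J scl r E \<Phi>"
    and "compatible_bundle_connection A J scl r E \<Phi> D_E"
    and "\<Gamma> = smooth_sections A scl r E \<Phi>"
    and "F = bundle_curvature \<Gamma> D_E" and "endo_form_zero A \<Gamma> 2 F"
    and "chern_connection A J \<omega> D_Ch" and "bismut_connection A J \<omega> D_B"
  shows "endo_form_zero A \<Gamma> 6 (wedge_endo scl 4 2 (wedge 2 2 \<omega> \<omega>) F) \<and>
         endo_form_zero A \<Gamma> 2 (type_part J 2 0 F) \<and>
         endo_form_zero A \<Gamma> 2 (type_part J 0 2 F) \<and>
         (\<forall>e. left_invariant_orthonormal_frame G A J \<omega> e \<longrightarrow>
           form_eq A 4 (\<lambda>Xs x. \<i> * del J 1 2 (delbar J 1 1 \<omega>) Xs x)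
             (\<lambda>Xs x. of_real (\<alpha>' / 4) *
                (tr_curv_sq A e (gauduchon_connection D_Ch D_B \<tau>) Xs x -
                 trace_form scl E \<Gamma> (endo_wedge_endo scl 2 2 F F) Xs x))) \<and>
         form_eq A 5 (ext_deriv (\<lambda>Xs x. of_real (form_norm A \<omega> \<Psi> x) * wedge 2 2 \<omega> \<omega> Xs x)) 0"
proof (intro conjI allI impI)
  note kaehler = assms(3)[unfolded left_invariant_kaehler_def]
  interpret lie_group_manifold G A by standard fact
  have hermitian: "hermitian_structure A J \<omega>" using kaehler by blast
  interpret kaehler_manifold A J \<omega>
    by unfold_locales (use kaehler in \<open>auto simp: hermitian_structure_def\<close>)
  have scl: "vector_space scl" using assms(6) by (simp add: holomorphic_bundle_def)
  have F: "F Ys s = 0" if "Ys \<in> field_lists A 2" for Ys s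
    using flat_bundle_curvature assms(9,10) that by blast
  show "endo_form_zero A \<Gamma> 6 (wedge_endo scl 4 2 (wedge 2 2 \<omega> \<omega>) F)"
    using flat_wedge_endo[OF scl, of 2 F \<Gamma> 4] F by simp
  show "endo_form_zero A \<Gamma> 2 (type_part J 2 0 F)" "endo_form_zero A \<Gamma> 2 (type_part J 0 2 F)"
    using flat_type_part[of 2 0 F \<Gamma>, unfolded add_0_right] flat_type_part[of 0 2 F \<Gamma>, unfolded add_0] F
    by blast+
  show "form_eq A 4 (\<lambda>Xs x. \<i> * del J 1 2 (delbar J 1 1 \<omega>) Xs x)
      (\<lambda>Xs x. of_real (\<alpha>' / 4) *
        (tr_curv_sq A e (gauduchon_connection D_Ch D_B \<tau>) Xs x -
         trace_form scl E \<Gamma> (endo_wedge_endo scl 2 2 F F) Xs x))"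
    if frame: "left_invariant_orthonormal_frame G A J \<omega> e" for e
  proof -
    interpret levi_civita A J \<omega> "gauduchon_connection D_Ch D_B \<tau>"
      by (rule gauduchon_levi_civita[OF kaehler_manifold_axioms assms(11,12)])
    interpret invariant_frame G A J \<omega> "gauduchon_connection D_Ch D_B \<tau>" e
      by unfold_locales (use kaehler frame in auto)
    show ?thesis
      using del_delbar_omega trace_curvature_squared[OF assms(2)] flat_trace_form[OF scl F]
      by (simp add: form_eq_def fun_eq_iff)
  qed
  have "form_norm A \<omega> \<Psi> = (\<lambda>_. form_norm A \<omega> \<Psi> \<one>\<^bsub>G\<^esub>)"
    using form_norm_constant[OF _ assms(5), of \<omega> _ "\<one>\<^bsub>G\<^esub>"] kaehler by (simp add: fun_eq_iff)
  then obtain c where "form_norm A \<omega> \<Psi> = (\<lambda>_. c)" by blast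
  moreover have "form_eq A 5 (ext_deriv (\<lambda>Xs. (\<lambda>_. of_real c) * wedge 2 2 \<omega> \<omega> Xs)) 0"
    by (rule closed_square[OF omega_form closed])
  ultimately show "form_eq A 5 (ext_deriv (\<lambda>Xs x. of_real (form_norm A \<omega> \<Psi> x) * wedge 2 2 \<omega> \<omega> Xs x)) 0"
    by (simp add: times_fun_def)
qed

end
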